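(* Let $n\ge3$. Let $(X,g)$ be an $n$-dimensional smooth complete connected Riemannian manifold without boundary, and let $Y_1,Y_2\subset X$ be $n$-dimensional closed connected $C^0$-submanifolds with nonempty boundaries $\partial Y_1$ and $\partial Y_2$ satisfying conditions (i) and (ii). Assume that $Y_1$ has property $(\circ)$ and that $X$ satisfies the following condition: $\rho_X(x,y)=\rho_Y(x,y)$ for any two points $x$ and $y$ on the boundary $\partial Y$ of every $n$-dimensional closed connected $C^0$-submanifold $Y$ with $\partial Y\neq\varnothing$ in $X$ satisfying (i), (ii) and $(\circ)$. Suppose also that $\partial Y_1$ and $\partial Y_2$ are isometric in the metrics $\rho_{Y_j}$, $j=1,2$. Then $\partial Y_1$ and $\partial Y_2$ are isometric in $\rho_X$.
   Context: $\rho_X(x,y)$ is the intrinsic metric of $X$: the infimum of the Riemannian lengths of smooth paths in $X$ joining $x$ and $y$. An $n$-dimensional $C^0$-submanifold $Y$ with boundary of an $n$-dimensional manifold $X$ is a subset which is an $n$-dimensional topological manifold with boundary in the induced topology; it is closed if it is a closed subset of $X$; $\partial Y$ is its boundary and $\mathrm{Int}\,Y=Y\setminus\partial Y$ its interior. Conditions on $Y$: (i) for all $x,y\in Y$, $$\rho_Y(x,y)=\liminf_{x'\to x,\;y'\to y;\;x',y'\in\mathrm{Int}\,Y}\{\inf[l(\gamma_{x',y',\mathrm{Int}\,Y})]\}<\infty,$$ where the infimum is over the Riemannian lengths of smooth paths $\gamma_{x',y',\mathrm{Int}\,Y}:[0,1]\to\mathrm{Int}\,Y$ joining $x'$ and $y'$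 in $\mathrm{Int}\,Y$ (this formula also defines $\rho_Y$); (ii) $\rho_Y$ is a metric on $Y$. A shortest path in the metric $\rho_Y$ between distinct points $x,y\in Y$ is a path $\gamma:[0,1]\to Y$ with $\gamma(0)=x$, $\gamma(1)=y$ and $\rho_Y(\gamma(s),\gamma(t))=(t-s)\rho_Y(x,y)$ for $0\le s<t\le1$. Paths are continuous and non-constant. $Y$ has property $(\circ)$ if, for any two points $x,y\in\partial Y$ and every shortest path $\gamma:[0,1]\to Y$ in the metric $\rho_Y$ joining them, $\gamma(]0,1[)\subset\mathrm{Int}\,Y$. $\partial Y_1$ and $\partial Y_2$ are isometric in the metrics $\rho_{Y_j}$ if there is a surjective map $f:\partial Y_1\to\partial Y_2$ with $\rho_{Y_2}(f(x),f(y))=\rho_{Y_1}(x,y)$ for all $x,y\in\partial Y_1$; they are isometric in $\rho_X$ if there is a surjective map $f:\partial Y_1\to\partial Y_2$ with $\rho_X(f(x),f(y))=\rho_X(x,y)$ for all $x,y\in\partial Y_1$. *)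

theory Defs
  imports "HOL-Analysis.Analysis"
begin

section \<open>Smooth maps\<close>

text \<open>
  Derivatives are taken within \<open>S\<close>.  The definition is used only for sets \<open>S\<close> on which they are
  unique: open subsets of a Euclidean space, and relatively open subsets of the interval
  \<open>{0..1}\<close> (one-sided derivatives at the endpoints).
\<close>

fun Ck_on :: "nat \<Rightarrow> 'a::real_normed_vector set \<Rightarrow> ('a \<Rightarrow> 'b::real_normed_vector) \<Rightarrow> bool" where
  "Ck_on 0 S f \<longleftrightarrow> continuous_on S f"
| "Ck_on (Suc k) S f \<longleftrightarrow>
     f differentiable_on S \<and> (\<forall>v. Ck_on k S (\<lambda>x. frechet_derivative f (at x within S) v))"

definition smooth_on :: "'a::real_normed_vector set \<Rightarrow> ('a \<Rightarrow> 'b::real_normed_vector) \<Rightarrow> bool" where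
  "smooth_on S f \<longleftrightarrow> (\<forall>k. Ck_on k S f)"


section \<open>Smooth manifolds\<close>

text \<open>
  The manifold is the whole type \<open>'a\<close>, whose topology is Hausdorff and second countable by type
  class; it is modelled on the Euclidean space \<open>'e\<close>, so its dimension is \<open>DIM('e)\<close>.  A chart
  \<open>(U, \<phi>)\<close> consists of its domain and a coordinate map, whose values outside \<open>U\<close> are irrelevant.
\<close>

type_synonym ('a, 'e) chart = "'a set \<times> ('a \<Rightarrow> 'e)"

abbreviation chart_inv :: "('a, 'e) chart \<Rightarrow> 'e \<Rightarrow> 'a" where
  "chart_inv c \<equiv> inv_into (fst c) (snd c)"

definition is_chart :: "('a::topological_space, 'e::euclidean_space) chart \<Rightarrow> bool" where
  "is_chart c \<longleftrightarrow> open (fst c) \<and> open (snd c ` fst c) \<and>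
     homeomorphism (fst c) (snd c ` fst c) (snd c) (chart_inv c)"

definition smooth_atlas ::
  "('a::{t2_space, second_countable_topology}, 'e::euclidean_space) chart set \<Rightarrow> bool" where
  "smooth_atlas A \<longleftrightarrow>
     (\<forall>c\<in>A. is_chart c) \<and> (\<Union>c\<in>A. fst c) = UNIV \<and>
     (\<forall>c\<in>A. \<forall>d\<in>A. smooth_on (snd c ` (fst c \<inter> fst d)) (snd d \<circ> chart_inv c))"


section \<open>Riemannian metrics\<close>

text \<open>
  A Riemannian metric is a smooth, symmetric, positive definite covariant 2-tensor field, given by
  its local expressions: \<open>g c p v w\<close> is the inner product of the tangent vectors at \<open>p\<close> whose
  coordinates in the chart \<open>c\<close> are \<open>v\<close> and \<open>w\<close>.  The last clause is the transformation law of
  such a tensor under a change of charts.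
\<close>

type_synonym ('a, 'e) metric_tensor = "('a, 'e) chart \<Rightarrow> 'a \<Rightarrow> 'e \<Rightarrow> 'e \<Rightarrow> real"

definition riemannian_metric ::
  "('a::topological_space, 'e::euclidean_space) chart set \<Rightarrow> ('a, 'e) metric_tensor \<Rightarrow> bool" where
  "riemannian_metric A g \<longleftrightarrow>
     (\<forall>c\<in>A. \<forall>p\<in>fst c. bilinear (g c p) \<and>
        (\<forall>v w. g c p v w = g c p w v) \<and> (\<forall>v. v \<noteq> 0 \<longrightarrow> g c p v v > 0)) \<and>
     (\<forall>c\<in>A. \<forall>v w. smooth_on (snd c ` fst c) (\<lambda>z. g c (chart_inv c z) v w)) \<and>
     (\<forall>c\<in>A. \<forall>d\<in>A. \<forall>p\<in>fst c \<inter> fst d. \<forall>v w.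
        let D = frechet_derivative (snd d \<circ> chart_inv c) (at (snd c p))
        in g c p v w = g d p (D v) (D w))"

definition smooth_path ::
  "('a::topological_space, 'e::euclidean_space) chart set \<Rightarrow> (real \<Rightarrow> 'a) \<Rightarrow> bool" where
  "smooth_path A \<gamma> \<longleftrightarrow>
     continuous_on {0..1} \<gamma> \<and> \<not> \<gamma> constant_on {0..1} \<and>
     (\<forall>c\<in>A. smooth_on {t\<in>{0..1}. \<gamma> t \<in> fst c} (snd c \<circ> \<gamma>))"

text \<open>
  The chart in which the speed is computed is immaterial, by the transformation law.
\<close>

definition speed ::
  "('a, 'e::euclidean_space) chart set \<Rightarrow> ('a, 'e) metric_tensor \<Rightarrow> (real \<Rightarrow> 'a) \<Rightarrow> real \<Rightarrow> real" where
  "speed A g \<gamma> t =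
     (let c = (SOME c. c \<in> A \<and> \<gamma> t \<in> fst c);
          v = vector_derivative (snd c \<circ> \<gamma>) (at t within {0..1})
      in sqrt (g c (\<gamma> t) v v))"

definition riem_length ::
  "('a, 'e::euclidean_space) chart set \<Rightarrow> ('a, 'e) metric_tensor \<Rightarrow> (real \<Rightarrow> 'a) \<Rightarrow> real" where
  "riem_length A g \<gamma> = integral {0..1} (speed A g \<gamma>)"

text \<open>
  \<open>path_dist A g S x y\<close> is the infimum of the lengths of the smooth paths from \<open>x\<close> to \<open>y\<close> that
  stay in \<open>S\<close>; it is \<open>\<infinity>\<close> if there is no such path.
\<close>

definition path_dist ::
  "('a::topological_space, 'e::euclidean_space) chart set \<Rightarrow> ('a, 'e) metric_tensor \<Rightarrow>
    'a set \<Rightarrow> 'a \<Rightarrow> 'a \<Rightarrow> ennreal" where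
  "path_dist A g S x y =
     (INF \<gamma> \<in> {\<gamma>. smooth_path A \<gamma> \<and> \<gamma> ` {0..1} \<subseteq> S \<and> \<gamma> 0 = x \<and> \<gamma> 1 = y}. ennreal (riem_length A g \<gamma>))"

abbreviation rho_X ::
  "('a::topological_space, 'e::euclidean_space) chart set \<Rightarrow> ('a, 'e) metric_tensor \<Rightarrow>
    'a \<Rightarrow> 'a \<Rightarrow> ennreal" where
  "rho_X A g \<equiv> path_dist A g UNIV"

definition complete_riemannian ::
  "('a::topological_space, 'e::euclidean_space) chart set \<Rightarrow> ('a, 'e) metric_tensor \<Rightarrow> bool" where
  "complete_riemannian A g \<longleftrightarrow> Metric_space.mcomplete UNIV (\<lambda>x y. enn2real (rho_X A g x y))"


section \<open>Topological submanifolds with boundary of full dimension\<close>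

text \<open>
  A boundary chart of \<open>Y\<close> is a homeomorphism from a relatively open subset \<open>U\<close> of \<open>Y\<close> onto a
  relatively open subset of a coordinate half-space of \<open>'e\<close>.
\<close>

definition half_space :: "'e::euclidean_space \<Rightarrow> 'e set" where
  "half_space b = {v. 0 \<le> v \<bullet> b}"

definition boundary_chart ::
  "'a::topological_space set \<Rightarrow> 'a set \<Rightarrow> ('a \<Rightarrow> 'e::euclidean_space) \<Rightarrow> 'e \<Rightarrow> bool" where
  "boundary_chart Y U h b \<longleftrightarrow>
     b \<in> Basis \<and> openin (top_of_set Y) U \<and> openin (top_of_set (half_space b)) (h ` U) \<and>
     (\<exists>k. homeomorphism U (h ` U) h k)"

definition C0_submanifold :: "'e::euclidean_space itself \<Rightarrow> 'a::topological_space set \<Rightarrow> bool" where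
  "C0_submanifold _ Y \<longleftrightarrow>
     (\<forall>y\<in>Y. \<exists>U (h :: 'a \<Rightarrow> 'e) b. boundary_chart Y U h b \<and> y \<in> U)"

definition mbdry :: "'e::euclidean_space itself \<Rightarrow> 'a::topological_space set \<Rightarrow> 'a set" where
  "mbdry _ Y =
     {y\<in>Y. \<exists>U (h :: 'a \<Rightarrow> 'e) b. boundary_chart Y U h b \<and> y \<in> U \<and> h y \<bullet> b = 0}"

definition mint :: "'e::euclidean_space itself \<Rightarrow> 'a::topological_space set \<Rightarrow> 'a set" where
  "mint E Y = Y - mbdry E Y"


section \<open>The metric of a submanifold\<close>

text \<open>
  The lower limit is over all pairs \<open>(x', y')\<close> of interior points tending to \<open>(x, y)\<close>, where
  \<open>x' = x\<close> and \<open>y' = y\<close> are allowed.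
\<close>

definition rho_Y ::
  "('a::topological_space, 'e::euclidean_space) chart set \<Rightarrow> ('a, 'e) metric_tensor \<Rightarrow>
    'a set \<Rightarrow> 'a \<Rightarrow> 'a \<Rightarrow> ennreal" where
  "rho_Y A g Y x y =
     (let I = mint TYPE('e) Y
      in Liminf (inf (nhds (x, y)) (principal (I \<times> I))) (\<lambda>(x', y'). path_dist A g I x' y'))"

definition cond_i ::
  "('a::topological_space, 'e::euclidean_space) chart set \<Rightarrow> ('a, 'e) metric_tensor \<Rightarrow>
    'a set \<Rightarrow> bool" where
  "cond_i A g Y \<longleftrightarrow> (\<forall>x\<in>Y. \<forall>y\<in>Y. rho_Y A g Y x y < \<infinity>)"

text \<open>
  \<open>Metric_space\<close> demands nonnegativity and symmetry on the whole type, not only on \<open>Y\<close>; here both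
  hold automatically, by the definition of \<open>enn2real\<close> and by reversing paths.
\<close>

definition cond_ii ::
  "('a::topological_space, 'e::euclidean_space) chart set \<Rightarrow> ('a, 'e) metric_tensor \<Rightarrow>
    'a set \<Rightarrow> bool" where
  "cond_ii A g Y \<longleftrightarrow> Metric_space Y (\<lambda>x y. enn2real (rho_Y A g Y x y))"

definition shortest_path ::
  "('a::topological_space, 'e::euclidean_space) chart set \<Rightarrow> ('a, 'e) metric_tensor \<Rightarrow>
    'a set \<Rightarrow> 'a \<Rightarrow> 'a \<Rightarrow> (real \<Rightarrow> 'a) \<Rightarrow> bool" where
  "shortest_path A g Y x y \<gamma> \<longleftrightarrow>
     x \<noteq> y \<and> continuous_on {0..1} \<gamma> \<and> \<gamma> ` {0..1} \<subseteq> Y \<and> \<gamma> 0 = x \<and> \<gamma> 1 = y \<and>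
     (\<forall>s t. 0 \<le> s \<and> s < t \<and> t \<le> 1 \<longrightarrow>
        rho_Y A g Y (\<gamma> s) (\<gamma> t) = ennreal (t - s) * rho_Y A g Y x y)"

definition circ_property ::
  "('a::topological_space, 'e::euclidean_space) chart set \<Rightarrow> ('a, 'e) metric_tensor \<Rightarrow>
    'a set \<Rightarrow> bool" where
  "circ_property A g Y \<longleftrightarrow>
     (\<forall>x\<in>mbdry TYPE('e) Y. \<forall>y\<in>mbdry TYPE('e) Y. \<forall>\<gamma>.
        shortest_path A g Y x y \<gamma> \<longrightarrow> \<gamma> ` {0<..<1} \<subseteq> mint TYPE('e) Y)"

definition admissible ::
  "('a::topological_space, 'e::euclidean_space) chart set \<Rightarrow> ('a, 'e) metric_tensor \<Rightarrow>
    'a set \<Rightarrow> bool" where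
  "admissible A g Y \<longleftrightarrow>
     C0_submanifold TYPE('e) Y \<and> closed Y \<and> connected Y \<and> mbdry TYPE('e) Y \<noteq> {} \<and>
     cond_i A g Y \<and> cond_ii A g Y"

definition isometric_wrt ::
  "('a \<Rightarrow> 'a \<Rightarrow> ennreal) \<Rightarrow> 'a set \<Rightarrow> ('b \<Rightarrow> 'b \<Rightarrow> ennreal) \<Rightarrow> 'b set \<Rightarrow> bool" where
  "isometric_wrt d1 S1 d2 S2 \<longleftrightarrow>
     (\<exists>f. f ` S1 = S2 \<and> (\<forall>x\<in>S1. \<forall>y\<in>S1. d2 (f x) (f y) = d1 x y))"

end

theory Submission
  imports Defs "HOL-Computational_Algebra.Polynomial"
begin

text \<open>
  The isometry for \<open>rho_X\<close> is the given isometry \<open>f\<close> for the intrinsic metrics.  Once \<open>Y2\<close> is known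
  to have the property \<open>circ_property\<close> as well, the hypothesis on \<open>X\<close> replaces \<open>rho_Y\<close> by \<open>rho_X\<close>
  on both boundaries, and nothing remains to be shown.

  The property passes from \<open>Y1\<close> to \<open>Y2\<close> because it can be read off from the distances between
  boundary points (\<open>circ_property_transfer\<close>).  Suppose that a shortest path of \<open>Y2\<close> between boundary
  points meets the boundary at a time \<open>t\<close> strictly between \<open>0\<close> and \<open>1\<close>.  Its end points and this
  third point split the distance in the ratio \<open>t : 1 - t\<close>, and so do their preimages \<open>a\<close>, \<open>b\<close>, \<open>c\<close>
  under \<open>f\<close>.  Shortest paths of \<open>Y1\<close> from \<open>a\<close> to \<open>c\<close> and from \<open>c\<close> to \<open>b\<close> then join to a shortest
  path from \<open>a\<close> to \<open>b\<close> (\<open>shortest_path_join\<close>) that passes through the boundary point \<open>c\<close>, which the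
  property of \<open>Y1\<close> forbids.

  So everything rests on the existence of shortest paths for \<open>rho_Y\<close> (\<open>shortest_path_exists\<close>).  By
  the definition of \<open>rho_Y x y\<close> as a lower limit, there are smooth paths in the interior of \<open>Y\<close>
  whose end points tend to \<open>x\<close> and \<open>y\<close> and whose lengths come arbitrarily close to
  \<open>L = rho_Y x y\<close>.  Parametrized proportionally to arc length they have a common Lipschitz constant
  for \<open>rho_X\<close>.  As \<open>X\<close> is complete and locally compact, their values at any fixed time are
  relatively compact: this is the argument of the Hopf-Rinow theorem, run along the time parameter
  (\<open>equi_Lipschitz_mtotally_bounded\<close>).  By Tychonoff's theorem the paths have a pointwise cluster
  point \<open>\<gamma>\<close>, which is Lipschitz and stays in the closed set \<open>Y\<close>.  A lower limit is lower
  semicontinuous, so \<open>rho_Y (\<gamma> s) (\<gamma> t) \<le> (t - s) L\<close>, and the triangle inequality of condition (ii)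
  forces equality here.

  What this uses about \<open>X\<close> is that \<open>rho_X\<close> is a metric which induces the topology of the manifold
  (\<open>Metric_space_distance\<close>, \<open>mtopology_eq\<close>).  Near a point, the Riemannian norm lies between two
  multiples of the Euclidean norm of a chart, so coordinate segments are short and short paths
  cannot leave a coordinate ball.  The triangle inequality takes more work, because only smooth
  paths are admitted: two paths with a common end point are concatenated after a reparametrization
  all of whose derivatives vanish at the joint (\<open>curve_Ck_glue_flat\<close>, \<open>riem_length_concat\<close>).
\<close>

section \<open>Smooth curves in a normed space\<close>

text \<open>
  For curves, repeated differentiation needs only one derivative function at each stage.
  Quantifying over that function, rather than naming it by a choice operator, lets derivatives that
  are computed piecewise or by the chain rule be used directly as witnesses.
\<close>
fun curve_Ck :: "nat \<Rightarrow> real set \<Rightarrow> (real \<Rightarrow> 'b::real_normed_vector) \<Rightarrow> bool" where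
  "curve_Ck 0 T f \<longleftrightarrow> continuous_on T f"
| "curve_Ck (Suc n) T f \<longleftrightarrow>
     (\<exists>f'. (\<forall>t\<in>T. (f has_vector_derivative f' t) (at t within T)) \<and> curve_Ck n T f')"

lemma curve_Ck_cong:
  assumes "\<And>t. t \<in> T \<Longrightarrow> f t = h t"
  shows "curve_Ck n T f \<longleftrightarrow> curve_Ck n T h"
proof (cases n)
  case 0
  show ?thesis using assms by (simp add: 0 cong: continuous_on_cong)
next
  case (Suc m)
  have "(f has_vector_derivative D) (at t within T) \<longleftrightarrow> (h has_vector_derivative D) (at t within T)"
    if "t \<in> T" for t D
    using assms that has_vector_derivative_transform by metis
  then show ?thesis by (simp add: Suc cong: ball_cong)
qed

lemma curve_Ck_continuous: "curve_Ck n T f \<Longrightarrow> continuous_on T f"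
  by (cases n) (auto intro: has_vector_derivative_continuous
      simp: continuous_on_eq_continuous_within)

lemma curve_Ck_Suc_D: "curve_Ck (Suc n) T f \<Longrightarrow> curve_Ck n T f"
proof (induction n arbitrary: f)
  case 0
  then show ?case using curve_Ck_continuous curve_Ck.simps(1) by blast
next
  case (Suc n)
  then show ?case by (metis curve_Ck.simps(2))
qed

lemma curve_Ck_add:
  "curve_Ck n T f \<Longrightarrow> curve_Ck n T h \<Longrightarrow> curve_Ck n T (\<lambda>t. f t + h t)"
proof (induction n arbitrary: f h)
  case 0
  then show ?case by (auto intro: continuous_on_add)
next
  case (Suc n)
  then obtain f' h' where
    f': "\<forall>t\<in>T. (f has_vector_derivative f' t) (at t within T)" "curve_Ck n T f'" and
    h': "\<forall>t\<in>T. (h has_vector_derivative h' t) (at t within T)" "curve_Ck n T h'" by auto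
  have "\<forall>t\<in>T. ((\<lambda>t. f t + h t) has_vector_derivative f' t + h' t) (at t within T)"
    using f' h' by (auto intro: has_vector_derivative_add)
  then show ?case using Suc.IH[OF f'(2) h'(2)] by auto
qed

lemma has_vector_derivative_compose_real:
  fixes f :: "real \<Rightarrow> 'b::real_normed_vector"
  assumes s: "(s has_real_derivative b) (at t)"
    and f: "(f has_vector_derivative w) (at (s t) within S)" and sub: "s ` R \<subseteq> S"
  shows "((\<lambda>t. f (s t)) has_vector_derivative b *\<^sub>R w) (at t within R)"
proof -
  have "(s has_vector_derivative b) (at t within R)"
    using s has_real_derivative_iff_has_vector_derivative has_vector_derivative_at_within by blast
  moreover have "(f has_vector_derivative w) (at (s t) within s ` R)"
    by (rule has_vector_derivative_within_subset[OF f sub])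
  ultimately show ?thesis using vector_diff_chain_within by (fastforce simp: o_def)
qed

lemma curve_Ck_affine:
  fixes f :: "real \<Rightarrow> 'b::real_normed_vector"
  assumes "curve_Ck n S f" and "\<And>t. t \<in> T \<Longrightarrow> c * t + d \<in> S"
  shows "curve_Ck n T (\<lambda>t. k *\<^sub>R f (c * t + d))"
  using assms(1)
proof (induction n arbitrary: f k)
  case 0
  then show ?case using assms(2)
    by (auto intro!: continuous_intros continuous_on_compose2[of S f])
next
  case (Suc n)
  then obtain f' where
    f': "\<forall>t\<in>S. (f has_vector_derivative f' t) (at t within S)" "curve_Ck n S f'" by auto
  have "((\<lambda>t. k *\<^sub>R f (c * t + d)) has_vector_derivative (k * c) *\<^sub>R f' (c * t + d)) (at t within T)"
    if "t \<in> T" for t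
  proof -
    have "((\<lambda>t. c * t + d) has_real_derivative c) (at t)"
      by (auto intro!: derivative_eq_intros)
    then have "((\<lambda>t. f (c * t + d)) has_vector_derivative c *\<^sub>R f' (c * t + d)) (at t within T)"
      by (rule has_vector_derivative_compose_real[where S = S]) (use f'(1) that assms(2) in auto)
    from has_vector_derivative_scaleR[OF DERIV_const this, of k] show ?thesis
      by simp
  qed
  then show ?case using Suc.IH[OF f'(2), of "k * c"]
    by (auto intro!: exI[of _ "\<lambda>t. (k * c) *\<^sub>R f' (c * t + d)"])
qed

lemma Ck_on_cong:
  assumes "\<And>t. t \<in> T \<Longrightarrow> f t = h t"
  shows "Ck_on n T f \<longleftrightarrow> Ck_on n T h"
  using assms
proof (induction n arbitrary: f h)
  case 0
  then show ?case by (simp cong: continuous_on_cong)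
next
  case (Suc n)
  have *: "(f has_derivative D) (at t within T) \<longleftrightarrow> (h has_derivative D) (at t within T)"
    if "t \<in> T" for t D
    using Suc.prems that has_derivative_transform by metis
  have "frechet_derivative f (at t within T) = frechet_derivative h (at t within T)"
    if "t \<in> T" for t
    by (simp add: frechet_derivative_def *[OF that])
  moreover have "f differentiable_on T \<longleftrightarrow> h differentiable_on T"
    unfolding differentiable_on_def differentiable_def using * by blast
  ultimately show ?case
    using Suc.IH[of "\<lambda>t. frechet_derivative f (at t within T) v"
        "\<lambda>t. frechet_derivative h (at t within T) v" for v] by simp
qed

text \<open>
  A Frechet derivative in one variable is multiplication by its value at \<open>1\<close>.  Without isolated
  points of \<open>T\<close> this value is unique, hence equal to any vector derivative.
\<close>
lemma Ck_on_iff_curve_Ck: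
  fixes f :: "real \<Rightarrow> 'b::real_normed_vector"
  assumes T: "\<And>t. t \<in> T \<Longrightarrow> at t within T \<noteq> bot"
  shows "Ck_on n T f \<longleftrightarrow> curve_Ck n T f"
proof (induction n arbitrary: f)
  case 0
  show ?case by simp
next
  case (Suc n)
  show ?case
  proof
    assume L: "Ck_on (Suc n) T f"
    have "(f has_vector_derivative frechet_derivative f (at t within T) 1) (at t within T)"
      if "t \<in> T" for t
    proof -
      have "f differentiable (at t within T)" using L that by (auto simp: differentiable_on_def)
      then have D: "(f has_derivative frechet_derivative f (at t within T)) (at t within T)"
        by (simp add: frechet_derivative_works)
      then interpret bounded_linear "frechet_derivative f (at t within T)"
        by (rule has_derivative_bounded_linear)
      have "frechet_derivative f (at t within T) = (\<lambda>v. v *\<^sub>R frechet_derivative f (at t within T) 1)"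
        by (rule ext) (metis mult.right_neutral real_scaleR_def scale)
      then show ?thesis using D by (simp add: has_vector_derivative_def)
    qed
    moreover have "curve_Ck n T (\<lambda>t. frechet_derivative f (at t within T) 1)"
      using L Suc.IH by auto
    ultimately show "curve_Ck (Suc n) T f"
      by (auto intro!: exI[of _ "\<lambda>t. frechet_derivative f (at t within T) 1"])
  next
    assume "curve_Ck (Suc n) T f"
    then obtain f' where
      f': "\<forall>t\<in>T. (f has_vector_derivative f' t) (at t within T)" "curve_Ck n T f'" by auto
    have D: "frechet_derivative f (at t within T) v = v *\<^sub>R f' t" if "t \<in> T" for t v
    proof -
      have d: "(f has_derivative (\<lambda>v. v *\<^sub>R f' t)) (at t within T)"
        using f' that by (simp add: has_vector_derivative_def)
      then have fd: "(f has_derivative frechet_derivative f (at t within T)) (at t within T)"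
        using frechet_derivative_works differentiable_def by blast
      then interpret bounded_linear "frechet_derivative f (at t within T)"
        by (rule has_derivative_bounded_linear)
      have eq: "frechet_derivative f (at t within T) = (\<lambda>v. v *\<^sub>R frechet_derivative f (at t within T) 1)"
        by (rule ext) (metis mult.right_neutral real_scaleR_def scale)
      then have "(f has_vector_derivative frechet_derivative f (at t within T) 1) (at t within T)"
        using fd by (simp add: has_vector_derivative_def)
      then have "frechet_derivative f (at t within T) 1 = f' t"
        using f' that T vector_derivative_unique_within by blast
      then show ?thesis using eq by metis
    qed
    have "Ck_on n T (\<lambda>t. frechet_derivative f (at t within T) v)" for v
    proof -
      have "curve_Ck n T (\<lambda>t. v *\<^sub>R f' t)"
        using curve_Ck_affine[OF f'(2), of T 1 0 v] by simp
      then have "Ck_on n T (\<lambda>t. v *\<^sub>R f' t)" using Suc.IH by blast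
      then show ?thesis using Ck_on_cong[of T "\<lambda>t. frechet_derivative f (at t within T) v"] D by simp
    qed
    moreover have "f differentiable_on T"
      using f' by (auto simp: differentiable_on_def differentiable_def has_vector_derivative_def)
    ultimately show "Ck_on (Suc n) T f" by simp
  qed
qed

text \<open>
  Along a line only derivatives in its fixed direction occur, and \<open>Ck_on\<close> passes to each directional
  derivative; so the induction step is the chain rule of first order.
\<close>
lemma curve_Ck_along_line:
  fixes f :: "'a::real_normed_vector \<Rightarrow> 'b::real_normed_vector"
  assumes "Ck_on n S f" and "\<And>t. t \<in> T \<Longrightarrow> p + t *\<^sub>R v \<in> S"
  shows "curve_Ck n T (\<lambda>t. f (p + t *\<^sub>R v))"
  using assms(1)
proof (induction n arbitrary: f)
  case 0
  then show ?case using assms(2)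
    by (auto intro!: continuous_intros continuous_on_compose2[of S f])
next
  case (Suc n)
  have "((\<lambda>t. f (p + t *\<^sub>R v)) has_vector_derivative
      frechet_derivative f (at (p + t *\<^sub>R v) within S) v) (at t within T)" if "t \<in> T" for t
  proof -
    let ?D = "frechet_derivative f (at (p + t *\<^sub>R v) within S)"
    have "f differentiable (at (p + t *\<^sub>R v) within S)"
      using Suc.prems that assms(2) by (auto simp: differentiable_on_def)
    then have D: "(f has_derivative ?D) (at (p + t *\<^sub>R v) within S)"
      by (simp add: frechet_derivative_works)
    then interpret bounded_linear ?D by (rule has_derivative_bounded_linear)
    have 1: "((\<lambda>t. p + t *\<^sub>R v) has_derivative (\<lambda>h. h *\<^sub>R v)) (at t within T)"
      by (auto intro!: derivative_eq_intros)
    have "((\<lambda>t. f (p + t *\<^sub>R v)) has_derivative (\<lambda>h. ?D (h *\<^sub>R v))) (at t within T)"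
      by (rule has_derivative_in_compose2[OF _ _ that 1, of S f])
        (use D assms(2) Suc.prems in \<open>auto simp: differentiable_on_def frechet_derivative_works\<close>)
    then show ?thesis by (simp add: has_vector_derivative_def scale)
  qed
  moreover have "curve_Ck n T (\<lambda>t. frechet_derivative f (at (p + t *\<^sub>R v) within S) v)"
    using Suc.IH[of "\<lambda>x. frechet_derivative f (at x within S) v"] Suc.prems by simp
  ultimately show ?case
    by (auto intro!: exI[of _ "\<lambda>t. frechet_derivative f (at (p + t *\<^sub>R v) within S) v"])
qed

section \<open>Functions that vanish to infinite order at 1/2\<close>

text \<open>
  \<open>flat n a\<close>: the function \<open>a\<close> is \<open>n\<close> times continuously differentiable and vanishes at \<open>1/2\<close>
  together with its derivatives up to order \<open>n\<close>.
\<close>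

fun flat :: "nat \<Rightarrow> (real \<Rightarrow> real) \<Rightarrow> bool" where
  "flat 0 a \<longleftrightarrow> continuous_on UNIV a \<and> a (1/2) = 0"
| "flat (Suc n) a \<longleftrightarrow> a (1/2) = 0 \<and> (\<exists>a'. (\<forall>t. (a has_real_derivative a' t) (at t)) \<and> flat n a')"

lemma flat_Suc_D: "flat (Suc n) a \<Longrightarrow> flat n a"
proof (induction n arbitrary: a)
  case 0
  then obtain a' where "\<forall>t. (a has_real_derivative a' t) (at t)" by auto
  then have "continuous_on UNIV a" by (meson DERIV_isCont continuous_at_imp_continuous_on)
  with 0 show ?case by simp
next
  case (Suc n)
  then show ?case by (metis flat.simps(2))
qed

lemma flat_add: "flat n a \<Longrightarrow> flat n b \<Longrightarrow> flat n (\<lambda>t. a t + b t)"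
proof (induction n arbitrary: a b)
  case 0
  then show ?case by (auto intro: continuous_on_add)
next
  case (Suc n)
  then obtain a' b' where
    "\<forall>t. (a has_real_derivative a' t) (at t)" "flat n a'"
    "\<forall>t. (b has_real_derivative b' t) (at t)" "flat n b'" by auto
  then show ?case using Suc.prems Suc.IH[of a' b']
    by (auto intro!: exI[of _ "\<lambda>t. a' t + b' t"] DERIV_add)
qed

lemma flat_mult: "flat n a \<Longrightarrow> flat n b \<Longrightarrow> flat n (\<lambda>t. a t * b t)"
proof (induction n arbitrary: a b)
  case 0
  then show ?case by (auto intro: continuous_on_mult)
next
  case (Suc n)
  then obtain a' b' where
    *: "\<forall>t. (a has_real_derivative a' t) (at t)" "flat n a'"
    "\<forall>t. (b has_real_derivative b' t) (at t)" "flat n b'" by auto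
  have "flat n (\<lambda>t. a' t * b t + a t * b' t)"
    using * Suc.prems[THEN flat_Suc_D] by (intro flat_add Suc.IH)
  then show ?case using * Suc.prems
    by (auto intro!: exI[of _ "\<lambda>t. a' t * b t + a t * b' t"] derivative_eq_intros)
qed

text \<open>
  For \<open>\<bar>x\<bar> < 1\<close> \<open>\<bar>1/x\<bar> ^ k\<close> is at most the \<open>k\<close>-th power of \<open>1/x^2\<close>, so each monomial reduces to
  \<open>y^k / exp y \<longlongrightarrow> 0\<close> for \<open>y = 1/x^2\<close> tending to infinity.
\<close>
lemma poly_mult_exp_tendsto_0:
  fixes p :: "real poly"
  shows "((\<lambda>x. poly p (inverse x) * exp (-((inverse x)^2))) \<longlongrightarrow> 0) (at 0)"
proof -
  have mono: "((\<lambda>x::real. (inverse x)^k * exp (-((inverse x)^2))) \<longlongrightarrow> 0) (at 0)" for k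
  proof (rule Lim_null_comparison)
    have "((\<lambda>x::real. x^2) \<longlongrightarrow> 0) (at 0)"
      using tendsto_power[OF tendsto_ident_at[of "0::real" UNIV], of 2] by simp
    moreover have "eventually (\<lambda>x::real. 0 < x^2) (at 0)"
      by (auto simp: eventually_at_filter)
    ultimately have lim: "filterlim (\<lambda>x::real. (inverse x)^2) at_top (at 0)"
      using filterlim_inverse_at_top[of "\<lambda>x::real. x^2"] by (simp add: power_inverse)
    show "((\<lambda>x::real. ((inverse x)^2)^k / exp ((inverse x)^2)) \<longlongrightarrow> 0) (at 0)"
      using filterlim_compose[OF tendsto_power_div_exp_0[of k] lim] by simp
    have "eventually (\<lambda>x::real. x \<in> {-1<..<1} - {0}) (at 0)"
      by (intro eventually_at_in_open) auto
    then show "eventually (\<lambda>x::real. norm ((inverse x)^k * exp (-((inverse x)^2)))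
        \<le> ((inverse x)^2)^k / exp ((inverse x)^2)) (at 0)"
    proof eventually_elim
      case (elim x)
      have a: "1 \<le> \<bar>inverse x\<bar>" using elim by (auto simp: field_simps abs_if)
      have "\<bar>inverse x\<bar>^k \<le> \<bar>inverse x\<bar>^(2*k)" by (rule power_increasing) (use a in auto)
      also have "\<dots> = ((inverse x)^2)^k"
        by (simp only: power_mult power2_abs)
      finally have "\<bar>inverse x\<bar>^k / exp ((inverse x)^2) \<le> ((inverse x)^2)^k / exp ((inverse x)^2)"
        by (intro divide_right_mono) auto
      moreover have "norm ((inverse x)^k * exp (-((inverse x)^2))) = \<bar>inverse x\<bar>^k / exp ((inverse x)^2)"
        by (simp only: real_norm_def abs_mult power_abs abs_exp_cancel exp_minus divide_inverse abs_inverse)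
      ultimately show ?case by simp
    qed
  qed
  have "((\<lambda>x. \<Sum>i\<le>degree p. coeff p i * ((inverse x)^i * exp (-((inverse x)^2))))
      \<longlongrightarrow> (\<Sum>i\<le>degree p. coeff p i * 0)) (at 0)"
    by (intro tendsto_intros mono)
  then show ?thesis
    by (simp add: poly_altdef sum_distrib_right mult.assoc)
qed

text \<open>
  With \<open>x = t - 1/2\<close> this is the classical flat function \<open>p (1/x) exp (-1/x^2)\<close>.  The polynomial
  factor makes the family closed under differentiation, which gives flatness of all orders by
  induction.
\<close>
definition flat_exp :: "real poly \<Rightarrow> real \<Rightarrow> real" where
  "flat_exp p t = (if t = 1/2 then 0 else
     poly p (inverse (t - 1/2)) * exp (-((inverse (t - 1/2))^2)))"

lemma flat_exp_deriv:
  "(flat_exp p has_real_derivative flat_exp (monom 2 3 * p - monom 1 2 * pderiv p) t) (at t)"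
proof (cases "t = 1/2")
  case True
  \<comment> \<open>the extra factor \<open>1/h\<close> of the difference quotient is absorbed into the polynomial\<close>
  have "((\<lambda>h. poly (pCons 0 p) (inverse h) * exp (-((inverse h)^2))) \<longlongrightarrow> 0) (at 0)"
    by (rule poly_mult_exp_tendsto_0)
  moreover have "eventually (\<lambda>h. poly (pCons 0 p) (inverse h) * exp (-((inverse h)^2)) =
      (flat_exp p (1/2 + h) - flat_exp p (1/2)) / h) (at 0)"
  proof -
    have "poly (pCons 0 p) (inverse h) * exp (-((inverse h)^2)) =
      (flat_exp p (1/2 + h) - flat_exp p (1/2)) / h" if "h \<noteq> 0" for h
    proof -
      have "flat_exp p (1/2 + h) = poly p (inverse h) * exp (-((inverse h)^2))"
        using that by (simp only: flat_exp_def add_diff_cancel_left' if_False add_cancel_left_right)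
      moreover have "flat_exp p (1/2) = 0" by (simp add: flat_exp_def)
      ultimately show ?thesis
        by (simp only: poly_pCons diff_zero add_0 divide_inverse mult_ac)
    qed
    then show ?thesis by (simp add: eventually_at_filter)
  qed
  ultimately have "((\<lambda>h. (flat_exp p (1/2 + h) - flat_exp p (1/2)) / h) \<longlongrightarrow> 0) (at 0)"
    by (rule Lim_transform_eventually)
  moreover have "flat_exp q (1/2) = 0" for q by (simp add: flat_exp_def)
  ultimately show ?thesis unfolding True DERIV_def by simp
next
  case False
  define u where "u = inverse (t - 1/2)"
  have 1: "((\<lambda>t. inverse (t - 1/2)) has_real_derivative -(u^2)) (at t)"
    using False by (auto intro!: derivative_eq_intros simp: u_def power2_eq_square)
  have 2: "(poly p has_real_derivative poly (pderiv p) u) (at u)"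
    by (rule poly_DERIV)
  have 3: "((\<lambda>u. exp (-(u^2))) has_real_derivative exp (-(u^2)) * -(2*u)) (at u)"
    by (auto intro!: derivative_eq_intros)
  have "((\<lambda>t. poly p (inverse (t - 1/2)) * exp (-((inverse (t - 1/2))^2))) has_real_derivative
     (poly (pderiv p) u * exp (-(u^2)) + (exp (-(u^2)) * -(2*u)) * poly p u) * -(u^2)) (at t)"
    using DERIV_chain2[OF DERIV_mult[OF 2 3, unfolded u_def] 1[unfolded u_def]] unfolding u_def .
  moreover have "flat_exp (monom 2 3 * p - monom 1 2 * pderiv p) t =
     (poly (pderiv p) u * exp (-(u^2)) + (exp (-(u^2)) * -(2*u)) * poly p u) * -(u^2)"
    using False unfolding flat_exp_def u_def[symmetric]
    by (simp add: poly_monom algebra_simps power2_eq_square power3_eq_cube)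
  ultimately have "((\<lambda>t. poly p (inverse (t - 1/2)) * exp (-((inverse (t - 1/2))^2)))
      has_real_derivative flat_exp (monom 2 3 * p - monom 1 2 * pderiv p) t) (at t)"
    by simp
  then show ?thesis
    by (rule has_field_derivative_transform_within_open[of _ _ _ "-{1/2}"])
      (use False in \<open>auto simp: flat_exp_def\<close>)
qed

lemma flat_flat_exp: "flat n (flat_exp p)"
proof (induction n arbitrary: p)
  case 0
  show ?case using DERIV_continuous_on[OF has_field_derivative_at_within[OF flat_exp_deriv]]
    by (auto simp: flat_exp_def)
next
  case (Suc n)
  have "flat_exp p (1/2) = 0" by (simp add: flat_exp_def)
  then show ?case using flat_exp_deriv[of p] Suc.IH by auto
qed

section \<open>Joining two curves smoothly\<close>

lemma has_vector_derivative_cases_le: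
  fixes f h :: "real \<Rightarrow> 'b::real_normed_vector"
  assumes t: "t \<in> T"
    and left: "t \<le> c \<Longrightarrow> (f has_vector_derivative f') (at t within {u\<in>T. u \<le> c})"
    and right: "c \<le> t \<Longrightarrow> (h has_vector_derivative h') (at t within {u\<in>T. c \<le> u})"
    and joint: "t = c \<Longrightarrow> f c = h c" "t = c \<Longrightarrow> f' = h'"
  shows "((\<lambda>u. if u \<le> c then f u else h u) has_vector_derivative (if t \<le> c then f' else h'))
     (at t within T)" (is "(?k has_vector_derivative _) _")
proof (cases t c rule: linorder_cases)
  case less
  have "(?k has_vector_derivative f') (at t within {u\<in>T. u \<le> c})"
    by (rule has_vector_derivative_transform[OF _ _ left]) (use less t in auto)
  moreover have "at t within {u\<in>T. u \<le> c} = at t within T"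
    by (rule at_within_nhd[of _ "{..<c}"]) (use less in auto)
  ultimately show ?thesis using less by simp
next
  case greater
  have "(?k has_vector_derivative h') (at t within {u\<in>T. c \<le> u})"
    by (rule has_vector_derivative_transform_within[OF right, of "t - c"])
      (use greater t in \<open>auto simp: dist_real_def\<close>)
  moreover have "at t within {u\<in>T. c \<le> u} = at t within T"
    by (rule at_within_nhd[of _ "{c<..}"]) (use greater in auto)
  ultimately show ?thesis using greater by simp
next
  case equal
  have "(?k has_vector_derivative f') (at t within {u\<in>T. u \<le> c})"
    by (rule has_vector_derivative_transform[OF _ _ left]) (use equal t in auto)
  moreover have "(?k has_vector_derivative h') (at t within {u\<in>T. c \<le> u})"
    by (rule has_vector_derivative_transform[OF _ _ right]) (use equal t joint in auto)
  moreover have eq: "at t within T = sup (at t within {u\<in>T. u \<le> c}) (at t within {u\<in>T. c \<le> u})"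
    by (subst at_within_union[symmetric]) (rule arg_cong[of _ _ "at_within t"], auto)
  ultimately have "(?k has_vector_derivative f') (at t within T)"
    unfolding has_vector_derivative_def has_derivative_within unfolding eq
    using equal joint by (auto intro: filterlim_sup)
  then show ?thesis using equal by simp
qed

text \<open>
  The factor \<open>a\<close> is flat, so both pieces, and all derivatives of both pieces, vanish at the joint.
  The derivative of \<open>a f (s t)\<close> is \<open>a' f (s t) + a b f' (s t)\<close>, where \<open>b\<close> is the common derivative of
  the two reparametrizations \<open>s1\<close> and \<open>s2\<close>: a sum of two functions of the same form, with the flat
  factors \<open>a'\<close> and \<open>a b\<close>.  The induction therefore has to range over all flat \<open>a\<close> and all \<open>f1\<close>, \<open>f2\<close>.
\<close>
lemma curve_Ck_glue_flat:
  fixes f1 f2 :: "real \<Rightarrow> 'b::real_normed_vector"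
  assumes s1: "\<And>t. (s1 has_real_derivative b t) (at t)" and m1: "\<And>t. t \<in> T \<Longrightarrow> t \<le> 1/2 \<Longrightarrow> s1 t \<in> T1"
    and s2: "\<And>t. (s2 has_real_derivative b t) (at t)" and m2: "\<And>t. t \<in> T \<Longrightarrow> 1/2 \<le> t \<Longrightarrow> s2 t \<in> T2"
    and b: "\<And>n. flat n b"
    and "flat n a" "curve_Ck n T1 f1" "curve_Ck n T2 f2"
  shows "curve_Ck n T (\<lambda>t. if t \<le> 1/2 then a t *\<^sub>R f1 (s1 t) else a t *\<^sub>R f2 (s2 t))"
  using assms(6-8)
proof (induction n arbitrary: a f1 f2)
  case 0
  have "continuous_on UNIV s1" "continuous_on UNIV s2"
    using s1 s2 by (meson DERIV_isCont continuous_at_imp_continuous_on)+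
  then have c: "continuous_on S s1" "continuous_on S s2" "continuous_on S a" for S
    using 0 by (auto intro: continuous_on_subset)
  have l: "continuous_on {t\<in>T. t \<le> 1/2} (\<lambda>t. a t *\<^sub>R f1 (s1 t))"
    by (rule continuous_on_scaleR[OF c(3) continuous_on_compose2[of T1 f1, OF _ c(1)]])
      (use 0 m1 in auto)
  have r: "continuous_on {t\<in>T. 1/2 \<le> t} (\<lambda>t. a t *\<^sub>R f2 (s2 t))"
    by (rule continuous_on_scaleR[OF c(3) continuous_on_compose2[of T2 f2, OF _ c(2)]])
      (use 0 m2 in auto)
  have z: "a t = 0" if "t = 1/2" for t
    unfolding that using 0 by simp
  show ?case unfolding curve_Ck.simps
    by (rule continuous_on_cases_le[OF l r continuous_on_id[unfolded id_def]])
      (use z in simp)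
next
  case (Suc n)
  obtain a' where a': "\<And>t. (a has_real_derivative a' t) (at t)" "flat n a'"
    using Suc.prems(1) by auto
  obtain f1' where f1': "\<And>t. t \<in> T1 \<Longrightarrow> (f1 has_vector_derivative f1' t) (at t within T1)" "curve_Ck n T1 f1'"
    using Suc.prems(2) by auto
  obtain f2' where f2': "\<And>t. t \<in> T2 \<Longrightarrow> (f2 has_vector_derivative f2' t) (at t within T2)" "curve_Ck n T2 f2'"
    using Suc.prems(3) by auto
  have zero: "a (1/2) = 0" "a' (1/2) = 0"
    using Suc.prems(1) a'(2) by (auto simp: flat.simps) (cases n; simp)+
  have D: "((\<lambda>t. a t *\<^sub>R f (\<sigma> t)) has_vector_derivative (a' t *\<^sub>R f (\<sigma> t) + (a t * b t) *\<^sub>R f' (\<sigma> t))) (at t within R)"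
    if "\<And>t. (\<sigma> has_real_derivative b t) (at t)" "(f has_vector_derivative f' (\<sigma> t)) (at (\<sigma> t) within S)"
      "\<sigma> ` R \<subseteq> S" for \<sigma> f f' t R and S :: "real set"
  proof -
    have "((\<lambda>t. f (\<sigma> t)) has_vector_derivative b t *\<^sub>R f' (\<sigma> t)) (at t within R)"
      by (rule has_vector_derivative_compose_real[OF that])
    from has_vector_derivative_scaleR[OF has_field_derivative_at_within[OF a'(1)] this]
    show ?thesis by (simp add: add.commute)
  qed
  let ?d1 = "\<lambda>t. a' t *\<^sub>R f1 (s1 t) + (a t * b t) *\<^sub>R f1' (s1 t)"
  let ?d2 = "\<lambda>t. a' t *\<^sub>R f2 (s2 t) + (a t * b t) *\<^sub>R f2' (s2 t)"
  have "((\<lambda>t. if t \<le> 1/2 then a t *\<^sub>R f1 (s1 t) else a t *\<^sub>R f2 (s2 t)) has_vector_derivative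
      (if t \<le> 1/2 then ?d1 t else ?d2 t)) (at t within T)" if "t \<in> T" for t
  proof (rule has_vector_derivative_cases_le)
    show "((\<lambda>t. a t *\<^sub>R f1 (s1 t)) has_vector_derivative ?d1 t) (at t within {u \<in> T. u \<le> 1/2})"
      if "t \<le> 1/2"
      by (rule D[of s1 f1 f1' _ T1]) (use s1 f1'(1) m1 that \<open>t \<in> T\<close> in auto)
    show "((\<lambda>t. a t *\<^sub>R f2 (s2 t)) has_vector_derivative ?d2 t) (at t within {u \<in> T. 1/2 \<le> u})"
      if "1/2 \<le> t"
      by (rule D[of s2 f2 f2' _ T2]) (use s2 f2'(1) m2 that \<open>t \<in> T\<close> in auto)
    show "?d1 t = ?d2 t" if "t = 1/2" unfolding that zero by simp
  qed (use that zero in auto)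
  moreover have "curve_Ck n T (\<lambda>t. if t \<le> 1/2 then ?d1 t else ?d2 t)"
  proof -
    have "curve_Ck n T (\<lambda>t. (if t \<le> 1/2 then a' t *\<^sub>R f1 (s1 t) else a' t *\<^sub>R f2 (s2 t)) +
        (if t \<le> 1/2 then (a t * b t) *\<^sub>R f1' (s1 t) else (a t * b t) *\<^sub>R f2' (s2 t)))"
      by (intro curve_Ck_add Suc.IH[OF a'(2)] Suc.IH[OF flat_mult[OF _ b]] f1'(2) f2'(2)
          Suc.prems(2,3)[THEN curve_Ck_Suc_D] Suc.prems(1)[THEN flat_Suc_D])
    then show ?thesis by (rule curve_Ck_cong[THEN iffD1, rotated]) auto
  qed
  ultimately show ?case
    by (auto intro!: exI[of _ "\<lambda>t. if t \<le> 1/2 then ?d1 t else ?d2 t"])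
qed

text \<open>
  An increasing bijection of the unit interval that fixes \<open>0\<close>, \<open>1/2\<close> and \<open>1\<close> and whose derivative
  \<open>flatten'\<close> is flat at \<open>1/2\<close>.  With \<open>x = t - 1/2\<close> it is \<open>1/2 + exp 4 x exp (-1/x^2)\<close>; since
  \<open>1/x^2 = 4\<close> at the end points, the factor \<open>exp 4\<close> fixes them.
\<close>
definition flatten :: "real \<Rightarrow> real" where
  "flatten t = 1/2 + exp 4 * ((t - 1/2) * exp (-((inverse (t - 1/2))^2)))"

definition flatten' :: "real \<Rightarrow> real" where
  "flatten' = flat_exp [:exp 4, 0, 2 * exp 4:]"

lemma flatten_simps: "flatten 0 = 0" "flatten (1/2) = 1/2" "flatten 1 = 1"
  by (simp_all add: flatten_def exp_minus power2_eq_square)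

lemma flatten'_nonneg: "0 \<le> flatten' t"
  by (auto simp: flatten'_def flat_exp_def)

lemma flat_flatten': "flat n flatten'"
  unfolding flatten'_def by (rule flat_flat_exp)

lemma flatten_deriv: "(flatten has_real_derivative flatten' t) (at t)"
proof (cases "t = 1/2")
  case True
  \<comment> \<open>the difference quotient of \<open>flatten\<close> at \<open>1/2\<close>\<close>
  have "((\<lambda>h. poly [:exp 4:] (inverse h) * exp (-((inverse h)^2))) \<longlongrightarrow> 0) (at (0::real))"
    by (rule poly_mult_exp_tendsto_0)
  moreover have "eventually (\<lambda>h. poly [:exp 4:] (inverse h) * exp (-((inverse h)^2)) =
      (flatten (1/2 + h) - flatten (1/2)) / h) (at 0)"
  proof -
    have "poly [:exp 4:] (inverse h) * exp (-((inverse h)^2)) =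
      (flatten (1/2 + h) - flatten (1/2)) / h" if "h \<noteq> 0" for h
      unfolding flatten_simps using that by (simp add: flatten_def)
    then show ?thesis by (simp add: eventually_at_filter)
  qed
  ultimately have "((\<lambda>h. (flatten (1/2 + h) - flatten (1/2)) / h) \<longlongrightarrow> 0) (at 0)"
    by (rule Lim_transform_eventually)
  moreover have "flatten' (1/2) = 0" by (simp add: flatten'_def flat_exp_def)
  ultimately show ?thesis unfolding True DERIV_def by simp
next
  case False
  define u where "u = inverse (t - 1/2)"
  have u: "(t - 1/2) * u = 1" using False by (simp add: u_def)
  have 1: "((\<lambda>t. inverse (t - 1/2)) has_real_derivative -(u^2)) (at t)"
    using False by (auto intro!: derivative_eq_intros simp: u_def power2_eq_square)
  have 2: "((\<lambda>t. exp (-((inverse (t - 1/2))^2))) has_real_derivative exp (-(u^2)) * -(2*u*-(u^2))) (at t)"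
    by (rule derivative_eq_intros 1 refl)+ (simp add: u_def)
  have 3: "(flatten has_real_derivative exp 4 * (1 * exp (-(u^2)) + (exp (-(u^2)) * -(2*u*-(u^2))) * (t - 1/2))) (at t)"
    unfolding flatten_def[abs_def]
    by (rule derivative_eq_intros 2 refl)+ (simp add: u_def)
  have "exp 4 * (1 * exp (-(u^2)) + (exp (-(u^2)) * -(2*u*-(u^2))) * (t - 1/2))
     = exp 4 * exp (-(u^2)) * (1 + 2*u^2*((t - 1/2)*u))"
    by (simp add: algebra_simps)
  also have "\<dots> = flatten' t" using False unfolding u flatten'_def flat_exp_def u_def[symmetric]
    by (simp add: algebra_simps power2_eq_square)
  finally show ?thesis using 3 by simp
qed

lemma flatten_mono: "s \<le> t \<Longrightarrow> flatten s \<le> flatten t"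
  using DERIV_nonneg_imp_nondecreasing flatten_deriv flatten'_nonneg by blast

section \<open>Speed and length of smooth paths\<close>

lemma at_within_openin:
  assumes "openin (top_of_set S) T" "t \<in> T"
  shows "at t within T = at t within S"
proof -
  obtain V where "open V" "T = S \<inter> V" using assms(1) by (auto simp: openin_open)
  then show ?thesis using assms(2) by (intro at_within_nhd[of _ V]) auto
qed

lemma at_within_unit_interval_neq_bot: "t \<in> {0..1} \<Longrightarrow> at t within {0..1::real} \<noteq> bot"
  by (simp add: trivial_limit_within islimpt_Icc)

lemma openin_path_preimage:
  "continuous_on {0..1::real} \<gamma> \<Longrightarrow> open U \<Longrightarrow> openin (top_of_set {0..1}) {t\<in>{0..1}. \<gamma> t \<in> U}"
  using continuous_openin_preimage_gen[of "{0..1}" \<gamma> U] by (simp add: vimage_def Int_def)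

locale riemannian =
  fixes A :: "('a::{t2_space, second_countable_topology}, 'e::euclidean_space) chart set"
    and g :: "('a, 'e) metric_tensor"
  assumes atlas: "smooth_atlas A" and metric: "riemannian_metric A g"
begin

lemma chart:
  assumes "c \<in> A"
  shows "open (fst c)" "open (snd c ` fst c)" "continuous_on (fst c) (snd c)"
    "continuous_on (snd c ` fst c) (chart_inv c)"
    "homeomorphism (fst c) (snd c ` fst c) (snd c) (chart_inv c)"
  using atlas assms by (auto simp: smooth_atlas_def is_chart_def homeomorphism_def)

lemma chart_inv_left: "c \<in> A \<Longrightarrow> p \<in> fst c \<Longrightarrow> chart_inv c (snd c p) = p"
  using chart(5) by (rule homeomorphism_apply1)

lemma chart_inv_right: "c \<in> A \<Longrightarrow> z \<in> snd c ` fst c \<Longrightarrow> snd c (chart_inv c z) = z"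
  using chart(5) by (rule homeomorphism_apply2)

lemma chart_inv_in: "z \<in> snd c ` fst c \<Longrightarrow> chart_inv c z \<in> fst c"
  by (rule inv_into_into)

lemma chart_at: obtains c where "c \<in> A" "p \<in> fst c"
proof -
  have "p \<in> (\<Union>c\<in>A. fst c)" using atlas by (simp add: smooth_atlas_def)
  then show ?thesis using that by blast
qed

lemma open_chart_image:
  assumes "c \<in> A" "open V" "V \<subseteq> fst c"
  shows "open (snd c ` V)"
proof -
  have "openin (top_of_set (fst c)) V"
    using assms by (auto simp: openin_open)
  then have "openin (top_of_set (snd c ` fst c)) (snd c ` V)"
    using homeomorphism_imp_open_map chart(5) assms(1) by blast
  then show ?thesis using chart(2)[OF assms(1)] openin_open_trans by blast
qed

lemma open_chart_preimage:
  "c \<in> A \<Longrightarrow> open W \<Longrightarrow> open {p \<in> fst c. snd c p \<in> W}"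
  using continuous_open_preimage[OF chart(3,1)] by (simp add: vimage_def Int_def)

lemma transition_smooth:
  "c \<in> A \<Longrightarrow> d \<in> A \<Longrightarrow> Ck_on n (snd c ` (fst c \<inter> fst d)) (snd d \<circ> chart_inv c)"
  using atlas by (auto simp: smooth_atlas_def smooth_on_def)

lemma g_bilinear: "c \<in> A \<Longrightarrow> p \<in> fst c \<Longrightarrow> bilinear (g c p)"
  and g_pos: "c \<in> A \<Longrightarrow> p \<in> fst c \<Longrightarrow> v \<noteq> 0 \<Longrightarrow> 0 < g c p v v"
  and g_continuous: "c \<in> A \<Longrightarrow> continuous_on (snd c ` fst c) (\<lambda>z. g c (chart_inv c z) v w)"
  and g_transform: "c \<in> A \<Longrightarrow> d \<in> A \<Longrightarrow> p \<in> fst c \<inter> fst d \<Longrightarrow>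
     g c p v w = g d p (frechet_derivative (snd d \<circ> chart_inv c) (at (snd c p)) v)
       (frechet_derivative (snd d \<circ> chart_inv c) (at (snd c p)) w)"
  using metric unfolding riemannian_metric_def smooth_on_def Let_def
  by (blast, blast, metis Ck_on.simps(1), blast)

lemma g_scale: "c \<in> A \<Longrightarrow> p \<in> fst c \<Longrightarrow> g c p (k *\<^sub>R v) (k *\<^sub>R v) = k^2 * g c p v v"
  using g_bilinear by (simp add: bilinear_lmul bilinear_rmul power2_eq_square)

lemma g_nonneg: "c \<in> A \<Longrightarrow> p \<in> fst c \<Longrightarrow> 0 \<le> g c p v v"
  using g_pos g_scale[of c p 0 v] by (cases "v = 0") (auto simp: less_imp_le)

text \<open>
  Smoothness of the metric tensor is given for fixed coordinate vectors only; this expansion turns it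
  into joint continuity in the point and the vectors.
\<close>
lemma g_expand:
  assumes "c \<in> A" "p \<in> fst c"
  shows "g c p v w = (\<Sum>(i,j)\<in>Basis \<times> Basis. (v \<bullet> i) * (w \<bullet> j) * g c p i j)"
proof -
  have "g c p v w = g c p (\<Sum>i\<in>Basis. (v \<bullet> i) *\<^sub>R i) (\<Sum>j\<in>Basis. (w \<bullet> j) *\<^sub>R j)"
    by (simp only: euclidean_representation)
  also have "\<dots> = (\<Sum>(i,j)\<in>Basis \<times> Basis. g c p ((v \<bullet> i) *\<^sub>R i) ((w \<bullet> j) *\<^sub>R j))"
    by (rule bilinear_sum[OF g_bilinear[OF assms]])
  also have "\<dots> = (\<Sum>(i,j)\<in>Basis \<times> Basis. (v \<bullet> i) * (w \<bullet> j) * g c p i j)"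
    using g_bilinear[OF assms] by (simp add: bilinear_lmul bilinear_rmul mult_ac)
  finally show ?thesis .
qed

text \<open>
  The definition of \<open>speed\<close> selects some chart \<open>d\<close> around the point.  The velocity in \<open>d\<close> is the
  derivative of the transition map applied to the velocity in \<open>c\<close>, and the transformation law of the
  metric tensor says that the two have the same norm.
\<close>
lemma speed_eq:
  assumes "continuous_on {0..1} \<gamma>" and t: "t \<in> {0..1}" and c: "c \<in> A" "\<gamma> t \<in> fst c"
    and v: "((snd c \<circ> \<gamma>) has_vector_derivative v) (at t within {0..1})"
  shows "speed A g \<gamma> t = sqrt (g c (\<gamma> t) v v)"
proof -
  define d where "d = (SOME c. c \<in> A \<and> \<gamma> t \<in> fst c)"
  have d: "d \<in> A" "\<gamma> t \<in> fst d"
    using someI[of "\<lambda>c. c \<in> A \<and> \<gamma> t \<in> fst c" c] c by (auto simp: d_def)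
  define \<tau> where "\<tau> = snd d \<circ> chart_inv c"
  define D where "D = frechet_derivative \<tau> (at (snd c (\<gamma> t)))"
  have "open (snd c ` (fst c \<inter> fst d))" using c d by (intro open_chart_image open_Int chart(1)) auto
  moreover have "\<tau> differentiable_on (snd c ` (fst c \<inter> fst d))"
    using transition_smooth[OF c(1) d(1), of 1] by (simp add: \<tau>_def)
  moreover have "snd c (\<gamma> t) \<in> snd c ` (fst c \<inter> fst d)" using c d by auto
  ultimately have "\<tau> differentiable at (snd c (\<gamma> t))"
    by (metis at_within_open differentiable_on_def)
  then have D: "(\<tau> has_derivative D) (at (snd c (\<gamma> t)))"
    unfolding D_def by (simp add: frechet_derivative_works)
  then interpret bounded_linear D by (rule has_derivative_bounded_linear)
  have "((\<lambda>s. \<tau> ((snd c \<circ> \<gamma>) s)) has_derivative (\<lambda>h. D (h *\<^sub>R v))) (at t within {0..1})"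
    using has_derivative_compose[OF v[unfolded has_vector_derivative_def]] D by simp
  then have hvd: "((\<lambda>s. \<tau> ((snd c \<circ> \<gamma>) s)) has_vector_derivative D v) (at t within {0..1})"
    by (simp add: has_vector_derivative_def scale)
  define T where "T = {s\<in>{0..1}. \<gamma> s \<in> fst c \<inter> fst d}"
  have eq: "at t within {0..1} = at t within T"
    using at_within_openin[OF openin_path_preimage[OF assms(1), of "fst c \<inter> fst d"], of t] t c d
      open_Int[OF chart(1)[OF c(1)] chart(1)[OF d(1)]]
    by (simp add: T_def)
  from hvd have "((snd d \<circ> \<gamma>) has_vector_derivative D v) (at t within {0..1})"
    unfolding eq
    by (rule has_vector_derivative_transform[rotated -1])
      (use c d t chart_inv_left in \<open>auto simp: T_def \<tau>_def\<close>)
  then have "vector_derivative (snd d \<circ> \<gamma>) (at t within {0..1}) = D v"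
    by (rule vector_derivative_within[OF at_within_unit_interval_neq_bot[OF t]])
  moreover have "g c (\<gamma> t) v v = g d (\<gamma> t) (D v) (D v)"
    unfolding D_def \<tau>_def using c d by (intro g_transform) auto
  ultimately show ?thesis by (simp add: speed_def d_def[symmetric] Let_def)
qed

text \<open>
  The parameters that a path maps into a chart form a relatively open subset of the unit interval,
  which has no isolated points; so \<open>Ck_on\<close> may be replaced by \<open>curve_Ck\<close>.
\<close>
lemma smooth_path_iff:
  "smooth_path A \<gamma> \<longleftrightarrow> continuous_on {0..1} \<gamma> \<and> \<not> \<gamma> constant_on {0..1} \<and>
     (\<forall>c\<in>A. \<forall>n. curve_Ck n {t\<in>{0..1}. \<gamma> t \<in> fst c} (snd c \<circ> \<gamma>))"
proof -
  have "smooth_on {t\<in>{0..1}. \<gamma> t \<in> fst c} (snd c \<circ> \<gamma>) \<longleftrightarrow>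
      (\<forall>n. curve_Ck n {t\<in>{0..1}. \<gamma> t \<in> fst c} (snd c \<circ> \<gamma>))"
    if "continuous_on {0..1} \<gamma>" "c \<in> A" for c
    unfolding smooth_on_def
    using at_within_openin[OF openin_path_preimage[OF that(1) chart(1)[OF that(2)]]]
      at_within_unit_interval_neq_bot
    by (subst Ck_on_iff_curve_Ck) auto
  then show ?thesis by (auto simp: smooth_path_def)
qed

lemma smooth_path_continuous: "smooth_path A \<gamma> \<Longrightarrow> continuous_on {0..1} \<gamma>"
  by (simp add: smooth_path_def)

lemma smooth_path_velocity:
  assumes "smooth_path A \<gamma>" "c \<in> A"
  obtains v where "continuous_on {t\<in>{0..1}. \<gamma> t \<in> fst c} v"
    "\<And>t. t \<in> {0..1} \<Longrightarrow> \<gamma> t \<in> fst c \<Longrightarrow> ((snd c \<circ> \<gamma>) has_vector_derivative v t) (at t within {0..1})"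
proof -
  let ?T = "{t\<in>{0..1}. \<gamma> t \<in> fst c}"
  have "curve_Ck (Suc 0) ?T (snd c \<circ> \<gamma>)" using assms unfolding smooth_path_iff by blast
  then obtain v where v: "continuous_on ?T v"
    "\<forall>t\<in>?T. ((snd c \<circ> \<gamma>) has_vector_derivative v t) (at t within ?T)" by auto
  moreover have "at t within ?T = at t within {0..1}" if "t \<in> ?T" for t
    by (rule at_within_openin[OF openin_path_preimage[OF smooth_path_continuous[OF assms(1)]
          chart(1)[OF assms(2)]] that])
  ultimately show ?thesis using that[of v] by simp
qed

lemma speed_continuous:
  assumes "smooth_path A \<gamma>"
  shows "continuous_on {0..1} (speed A g \<gamma>)"
proof -
  note cont = smooth_path_continuous[OF assms]
  have "continuous (at t within {0..1}) (speed A g \<gamma>)" if t: "t \<in> {0..1}" for t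
  proof -
    obtain c where c: "c \<in> A" "\<gamma> t \<in> fst c" using chart_at .
    let ?T = "{t\<in>{0..1}. \<gamma> t \<in> fst c}"
    obtain v where v: "continuous_on ?T v"
      "\<And>t. t \<in> {0..1} \<Longrightarrow> \<gamma> t \<in> fst c \<Longrightarrow> ((snd c \<circ> \<gamma>) has_vector_derivative v t) (at t within {0..1})"
      using smooth_path_velocity[OF assms c(1)] by blast
    have "continuous_on ?T (\<lambda>t. g c (\<gamma> t) i j)" for i j
    proof -
      have "continuous_on ?T (\<lambda>t. snd c (\<gamma> t))"
        by (rule continuous_on_compose2[OF chart(3)[OF c(1)] continuous_on_subset[OF cont]]) auto
      then have "continuous_on ?T (\<lambda>t. g c (chart_inv c (snd c (\<gamma> t))) i j)"
        by (rule continuous_on_compose2[OF g_continuous[OF c(1)]]) auto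
      then show ?thesis
        by (rule continuous_on_cong[THEN iffD1, rotated -1]) (auto simp: chart_inv_left c)
    qed
    then have "continuous_on ?T (\<lambda>t. sqrt (\<Sum>(i,j)\<in>Basis \<times> Basis. (v t \<bullet> i) * (v t \<bullet> j) * g c (\<gamma> t) i j))"
      unfolding case_prod_beta by (intro continuous_intros v(1))
    moreover have "speed A g \<gamma> t = sqrt (\<Sum>(i,j)\<in>Basis \<times> Basis. (v t \<bullet> i) * (v t \<bullet> j) * g c (\<gamma> t) i j)"
      if "t \<in> ?T" for t
      using speed_eq[OF cont _ c(1) _ v(2)] g_expand[OF c(1)] that by simp
    ultimately have "continuous_on ?T (speed A g \<gamma>)"
      by (subst continuous_on_cong[OF refl]) (assumption | rule)+
    then have "continuous (at t within ?T) (speed A g \<gamma>)"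
      using t c by (simp add: continuous_on_eq_continuous_within)
    then show ?thesis
      using at_within_openin[OF openin_path_preimage[OF cont chart(1)[OF c(1)]]] t c by simp
  qed
  then show ?thesis by (simp add: continuous_on_eq_continuous_within)
qed

lemma speed_nonneg:
  assumes "smooth_path A \<gamma>" "t \<in> {0..1}"
  shows "0 \<le> speed A g \<gamma> t"
proof -
  obtain c where c: "c \<in> A" "\<gamma> t \<in> fst c" using chart_at .
  obtain v where "((snd c \<circ> \<gamma>) has_vector_derivative v t) (at t within {0..1})"
    using smooth_path_velocity[OF assms(1) c(1)] assms(2) c(2) by metis
  from speed_eq[OF smooth_path_continuous[OF assms(1)] assms(2) c this] show ?thesis
    by (simp add: g_nonneg c)
qed

lemma speed_integrable:
  assumes "smooth_path A \<gamma>" "0 \<le> a" "b \<le> 1"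
  shows "speed A g \<gamma> integrable_on {a..b}"
proof (rule integrable_continuous_real)
  show "continuous_on {a..b} (speed A g \<gamma>)"
    by (rule continuous_on_subset[OF speed_continuous[OF assms(1)]]) (use assms(2,3) in auto)
qed

lemma riem_length_nonneg:
  assumes "smooth_path A \<gamma>"
  shows "0 \<le> riem_length A g \<gamma>"
  unfolding riem_length_def
proof (rule integral_nonneg)
  show "speed A g \<gamma> integrable_on {0..1}" using speed_integrable[OF assms] by simp
  show "0 \<le> speed A g \<gamma> t" if "t \<in> {0..1}" for t using speed_nonneg[OF assms that] .
qed

lemma smooth_path_affine:
  assumes \<gamma>: "smooth_path A \<gamma>" and \<alpha>: "\<And>t. t \<in> {0..1} \<Longrightarrow> k * t + e \<in> {0..1}"
    and nc: "\<not> (\<lambda>t. \<gamma> (k * t + e)) constant_on {0..1}"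
  shows "smooth_path A (\<lambda>t. \<gamma> (k * t + e))"
    and "\<And>t. t \<in> {0..1} \<Longrightarrow> speed A g (\<lambda>t. \<gamma> (k * t + e)) t = \<bar>k\<bar> * speed A g \<gamma> (k * t + e)"
proof -
  let ?\<gamma> = "\<lambda>t. \<gamma> (k * t + e)"
  have cont: "continuous_on {0..1} ?\<gamma>"
  proof (rule continuous_on_compose2[OF smooth_path_continuous[OF \<gamma>]])
    show "continuous_on {0..1} (\<lambda>t. k * t + e)" by (intro continuous_intros)
    show "(\<lambda>t. k * t + e) ` {0..1} \<subseteq> {0..1}" using \<alpha> by blast
  qed
  have "curve_Ck n {t \<in> {0..1}. ?\<gamma> t \<in> fst c} (snd c \<circ> ?\<gamma>)" if "c \<in> A" for n c
  proof -
    have "curve_Ck n {t \<in> {0..1}. \<gamma> t \<in> fst c} (snd c \<circ> \<gamma>)" using \<gamma> that smooth_path_iff by simp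
    then have "curve_Ck n {t \<in> {0..1}. ?\<gamma> t \<in> fst c} (\<lambda>t. 1 *\<^sub>R (snd c \<circ> \<gamma>) (k * t + e))"
      by (rule curve_Ck_affine) (use \<alpha> in auto)
    then show ?thesis by (simp add: o_def)
  qed
  then show "smooth_path A ?\<gamma>" using cont nc by (simp add: smooth_path_iff)
  fix t :: real assume t: "t \<in> {0..1}"
  obtain c where c: "c \<in> A" "?\<gamma> t \<in> fst c" using chart_at .
  obtain v where v: "((snd c \<circ> \<gamma>) has_vector_derivative v) (at (k * t + e) within {0..1})"
    using smooth_path_velocity[OF \<gamma> c(1)] \<alpha>[OF t] c(2) by metis
  have "((\<lambda>t. k * t + e) has_real_derivative k) (at t)"
    by (auto intro!: derivative_eq_intros)
  then have "((\<lambda>t. (snd c \<circ> \<gamma>) (k * t + e)) has_vector_derivative k *\<^sub>R v) (at t within {0..1})"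
    by (rule has_vector_derivative_compose_real[where S = "{0..1}"]) (rule v, use \<alpha> in auto)
  then have "((snd c \<circ> ?\<gamma>) has_vector_derivative k *\<^sub>R v) (at t within {0..1})"
    by (simp add: o_def)
  from speed_eq[OF cont t c this] have "speed A g ?\<gamma> t = \<bar>k\<bar> * sqrt (g c (?\<gamma> t) v v)"
    by (simp add: g_scale c real_sqrt_mult)
  moreover have "speed A g \<gamma> (k * t + e) = sqrt (g c (?\<gamma> t) v v)"
    by (rule speed_eq[OF smooth_path_continuous[OF \<gamma>] \<alpha>[OF t] c v])
  ultimately show "speed A g ?\<gamma> t = \<bar>k\<bar> * speed A g \<gamma> (k * t + e)" by simp
qed

lemma riem_length_subpath:
  assumes \<gamma>: "smooth_path A \<gamma>" and ab: "0 \<le> a" "a \<le> b" "b \<le> 1"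
    and nc: "\<not> (\<lambda>t. \<gamma> ((b - a) * t + a)) constant_on {0..1}"
  shows "smooth_path A (\<lambda>t. \<gamma> ((b - a) * t + a))"
    and "riem_length A g (\<lambda>t. \<gamma> ((b - a) * t + a)) = integral {a..b} (speed A g \<gamma>)"
proof -
  have \<alpha>: "(b - a) * t + a \<in> {a..b}" if "t \<in> {0..1}" for t
    using ab that mult_left_le[of t "b - a"] by auto
  then have \<alpha>': "(b - a) * t + a \<in> {0..1}" if "t \<in> {0..1}" for t
    using ab that by fastforce
  note sp = smooth_path_affine[OF \<gamma> \<alpha>' nc]
  show "smooth_path A (\<lambda>t. \<gamma> ((b - a) * t + a))" using sp(1) by simp
  have "((\<lambda>t. (b - a) *\<^sub>R speed A g \<gamma> ((b - a) * t + a)) has_integral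
      integral {(b - a) * 0 + a .. (b - a) * 1 + a} (speed A g \<gamma>)) {0..1}"
    by (rule has_integral_substitution[of 0 1 "\<lambda>t. (b - a) * t + a" a b])
      (use ab \<alpha> in \<open>auto intro!: derivative_eq_intros continuous_on_subset[OF speed_continuous[OF \<gamma>]]\<close>)
  then have "((\<lambda>t. (b - a) *\<^sub>R speed A g \<gamma> ((b - a) * t + a)) has_integral
      integral {a..b} (speed A g \<gamma>)) {0..1}"
    by simp
  then have "(speed A g (\<lambda>t. \<gamma> ((b - a) * t + a)) has_integral integral {a..b} (speed A g \<gamma>)) {0..1}"
    by (rule has_integral_eq[rotated]) (use sp(2) ab in auto)
  then show "riem_length A g (\<lambda>t. \<gamma> ((b - a) * t + a)) = integral {a..b} (speed A g \<gamma>)"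
    by (simp add: riem_length_def integral_unique)
qed

text \<open>
  Reversal is an affine reparametrization with slope \<open>-1\<close>, which leaves the speed unchanged.
\<close>
lemma riem_length_reverse:
  assumes \<gamma>: "smooth_path A \<gamma>"
  shows "smooth_path A (\<lambda>t. \<gamma> (1 - t))" "riem_length A g (\<lambda>t. \<gamma> (1 - t)) = riem_length A g \<gamma>"
proof -
  have "\<not> (\<lambda>t. \<gamma> (-1 * t + 1)) constant_on {0..1}"
  proof
    assume "(\<lambda>t. \<gamma> (-1 * t + 1)) constant_on {0..1}"
    then obtain y where y: "\<gamma> (-1 * t + 1) = y" if "t \<in> {0..1}" for t by (auto simp: constant_on_def)
    have "\<gamma> t = y" if "t \<in> {0..1}" for t using y[of "1 - t"] that by simp
    then show False using \<gamma> by (auto simp: smooth_path_def constant_on_def)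
  qed
  note sp = smooth_path_affine[OF \<gamma> _ this]
  show "smooth_path A (\<lambda>t. \<gamma> (1 - t))" using sp(1) by (simp add: add.commute)
  have "((\<lambda>t. (-1) *\<^sub>R speed A g \<gamma> (1 - t)) has_integral
      (integral {1 - 0..1 - 1} (speed A g \<gamma>) - integral {1 - 1..1 - 0} (speed A g \<gamma>))) {0..1}"
    by (rule has_integral_substitution_general[of "{}" 0 1 "\<lambda>t. 1 - t" 0 1])
      (auto intro!: derivative_eq_intros continuous_intros speed_continuous[OF \<gamma>])
  from has_integral_neg[OF this]
  have "((\<lambda>t. speed A g \<gamma> (1 - t)) has_integral riem_length A g \<gamma>) {0..1}"
    by (simp add: riem_length_def)
  then have "(speed A g (\<lambda>t. \<gamma> (1 - t)) has_integral riem_length A g \<gamma>) {0..1}"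
    by (rule has_integral_eq[rotated]) (use sp(2) in \<open>auto simp: add.commute\<close>)
  then show "riem_length A g (\<lambda>t. \<gamma> (1 - t)) = riem_length A g \<gamma>"
    unfolding riem_length_def[of A g "\<lambda>t. \<gamma> (1 - t)"] by (rule integral_unique)
qed

text \<open>
  On each half \<open>\<gamma>\<close> is one of the given paths, run with the speed factor \<open>b = 2 flatten'\<close>.  This
  factor is flat at the joint, so the derivatives of the two halves fit together there by
  \<open>curve_Ck_glue_flat\<close>; the lengths are computed by substitution on each half.
\<close>
lemma riem_length_concat:
  assumes \<gamma>: "smooth_path A \<gamma>1" "smooth_path A \<gamma>2" and joint: "\<gamma>1 1 = \<gamma>2 0"
  defines "\<gamma> \<equiv> \<lambda>t. if t \<le> 1/2 then \<gamma>1 (2 * flatten t) else \<gamma>2 (2 * flatten t - 1)"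
  shows "smooth_path A \<gamma>" "riem_length A g \<gamma> = riem_length A g \<gamma>1 + riem_length A g \<gamma>2"
    "\<gamma> ` {0..1} \<subseteq> \<gamma>1 ` {0..1} \<union> \<gamma>2 ` {0..1}"
proof -
  define s1 s2 where "s1 = (\<lambda>t. 2 * flatten t)" and "s2 = (\<lambda>t. 2 * flatten t - 1)"
  define b where "b = (\<lambda>t. 2 * flatten' t)"
  have s1: "(s1 has_real_derivative b t) (at t)" and s2: "(s2 has_real_derivative b t) (at t)" for t
    unfolding s1_def s2_def b_def by (auto intro!: derivative_eq_intros flatten_deriv)
  have b: "flat n b" for n
  proof -
    have "flat n (\<lambda>t. flatten' t + flatten' t)" by (intro flat_add flat_flatten')
    then show ?thesis by (simp add: b_def)
  qed
  have b0: "b (1/2) = 0" using b[of 0] by simp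
  have bnn: "0 \<le> b t" for t by (simp add: b_def flatten'_nonneg)
  have cont_s: "continuous_on S s1" "continuous_on S s2" for S
    by (meson s1 s2 DERIV_isCont continuous_at_imp_continuous_on)+
  have m1: "s1 t \<in> {0..1}" if "0 \<le> t" "t \<le> 1/2" for t
    using flatten_mono[of 0 t] flatten_mono[of t "1/2"] that flatten_simps by (simp add: s1_def)
  have m2: "s2 t \<in> {0..1}" if "1/2 \<le> t" "t \<le> 1" for t
    using flatten_mono[of "1/2" t] flatten_mono[of t 1] that flatten_simps by (simp add: s2_def)
  have ends: "s1 0 = 0" "s1 (1/2) = 1" "s2 (1/2) = 0" "s2 1 = 1"
    unfolding s1_def s2_def flatten_simps by simp_all
  have i2: "\<gamma>2 (s2 t) = \<gamma> t" if "1/2 \<le> t" for t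
  proof (cases "t = 1/2")
    case True
    show ?thesis unfolding True ends \<gamma>_def flatten_simps using joint by simp
  qed (use that in \<open>simp add: \<gamma>_def s2_def\<close>)
  have \<gamma>_eq: "\<gamma> = (\<lambda>t. if t \<le> 1/2 then \<gamma>1 (s1 t) else \<gamma>2 (s2 t))"
    unfolding \<gamma>_def s1_def s2_def by (rule refl)
  show "\<gamma> ` {0..1} \<subseteq> \<gamma>1 ` {0..1} \<union> \<gamma>2 ` {0..1}"
    using m1 m2 by (auto simp: \<gamma>_eq)
  have cont: "continuous_on {0..1} \<gamma>"
    unfolding \<gamma>_eq
  proof (rule continuous_on_cases_le)
    show "continuous_on {t \<in> {0..1}. t \<le> 1/2} (\<lambda>t. \<gamma>1 (s1 t))"
      by (rule continuous_on_compose2[OF smooth_path_continuous[OF \<gamma>(1)] cont_s(1)]) (use m1 in auto)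
    show "continuous_on {t \<in> {0..1}. 1/2 \<le> t} (\<lambda>t. \<gamma>2 (s2 t))"
      by (rule continuous_on_compose2[OF smooth_path_continuous[OF \<gamma>(2)] cont_s(2)]) (use m2 in auto)
    show "\<gamma>1 (s1 t) = \<gamma>2 (s2 t)" if "t = 1/2" for t
      unfolding that ends by (rule joint)
  qed (auto intro: continuous_intros)
  have nc: "\<not> \<gamma> constant_on {0..1}"
  proof
    assume "\<gamma> constant_on {0..1}"
    then obtain y where y: "\<And>t. t \<in> {0..1} \<Longrightarrow> \<gamma> t = y" by (auto simp: constant_on_def)
    have "\<gamma>1 u = y" if u: "u \<in> {0..1}" for u
    proof -
      obtain t where "0 \<le> t" "t \<le> 1/2" "s1 t = u"
        using IVT'[of s1 0 u "1/2"] ends u cont_s by auto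
      then show ?thesis using y[of t] by (simp add: \<gamma>_eq)
    qed
    then show False using \<gamma>(1) by (auto simp: smooth_path_def constant_on_def)
  qed
  have "curve_Ck n {t \<in> {0..1}. \<gamma> t \<in> fst c} (snd c \<circ> \<gamma>)" if c: "c \<in> A" for n c
  proof (cases n)
    case 0
    have "continuous_on {t \<in> {0..1}. \<gamma> t \<in> fst c} (\<lambda>t. snd c (\<gamma> t))"
      by (rule continuous_on_compose2[OF chart(3)[OF c] continuous_on_subset[OF cont]]) auto
    then show ?thesis by (simp add: 0 o_def)
  next
    case (Suc m)
    let ?T = "{t \<in> {0..1}. \<gamma> t \<in> fst c}"
    let ?T1 = "{t \<in> {0..1}. \<gamma>1 t \<in> fst c}" and ?T2 = "{t \<in> {0..1}. \<gamma>2 t \<in> fst c}"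
    have mT: "t \<in> ?T \<Longrightarrow> t \<le> 1/2 \<Longrightarrow> s1 t \<in> ?T1" for t
      using m1 by (auto simp: \<gamma>_eq)
    have mT2: "t \<in> ?T \<Longrightarrow> 1/2 \<le> t \<Longrightarrow> s2 t \<in> ?T2" for t
      using m2 i2[of t] by auto
    have "curve_Ck (Suc m) ?T1 (snd c \<circ> \<gamma>1)" using \<gamma>(1) c unfolding smooth_path_iff by blast
    then obtain f1' where f1': "\<And>t. t \<in> ?T1 \<Longrightarrow> ((snd c \<circ> \<gamma>1) has_vector_derivative f1' t) (at t within ?T1)"
      "curve_Ck m ?T1 f1'"
      unfolding curve_Ck.simps by blast
    have "curve_Ck (Suc m) ?T2 (snd c \<circ> \<gamma>2)" using \<gamma>(2) c unfolding smooth_path_iff by blast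
    then obtain f2' where f2': "\<And>t. t \<in> ?T2 \<Longrightarrow> ((snd c \<circ> \<gamma>2) has_vector_derivative f2' t) (at t within ?T2)"
      "curve_Ck m ?T2 f2'"
      unfolding curve_Ck.simps by blast
    have "((\<lambda>t. if t \<le> 1/2 then (snd c \<circ> \<gamma>1) (s1 t) else (snd c \<circ> \<gamma>2) (s2 t)) has_vector_derivative
        (if t \<le> 1/2 then b t *\<^sub>R f1' (s1 t) else b t *\<^sub>R f2' (s2 t))) (at t within ?T)" if "t \<in> ?T" for t
    proof (rule has_vector_derivative_cases_le)
      show "((\<lambda>t. (snd c \<circ> \<gamma>1) (s1 t)) has_vector_derivative b t *\<^sub>R f1' (s1 t))
          (at t within {u \<in> ?T. u \<le> 1/2})" if "t \<le> 1/2"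
        by (rule has_vector_derivative_compose_real[OF s1 f1'(1)[OF mT]]) (use mT that \<open>t \<in> ?T\<close> in auto)
      show "((\<lambda>t. (snd c \<circ> \<gamma>2) (s2 t)) has_vector_derivative b t *\<^sub>R f2' (s2 t))
          (at t within {u \<in> ?T. 1/2 \<le> u})" if "1/2 \<le> t"
        by (rule has_vector_derivative_compose_real[OF s2 f2'(1)[OF mT2]]) (use mT2 that \<open>t \<in> ?T\<close> in auto)
      show "(snd c \<circ> \<gamma>1) (s1 (1/2)) = (snd c \<circ> \<gamma>2) (s2 (1/2))"
        unfolding ends by (simp add: joint)
      show "b t *\<^sub>R f1' (s1 t) = b t *\<^sub>R f2' (s2 t)" if "t = 1/2"
        unfolding that by (simp only: b0 scaleR_zero_left)
    qed (use that in auto)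
    moreover have "curve_Ck m ?T (\<lambda>t. if t \<le> 1/2 then b t *\<^sub>R f1' (s1 t) else b t *\<^sub>R f2' (s2 t))"
      by (rule curve_Ck_glue_flat[OF s1 mT s2 mT2 b b f1'(2) f2'(2)])
    ultimately have "curve_Ck n ?T (\<lambda>t. if t \<le> 1/2 then (snd c \<circ> \<gamma>1) (s1 t) else (snd c \<circ> \<gamma>2) (s2 t))"
      unfolding Suc curve_Ck.simps
      by (intro exI[of _ "\<lambda>t. if t \<le> 1/2 then b t *\<^sub>R f1' (s1 t) else b t *\<^sub>R f2' (s2 t)"] conjI ballI)
    then show ?thesis by (rule curve_Ck_cong[THEN iffD1, rotated]) (auto simp: \<gamma>_eq)
  qed
  then show "smooth_path A \<gamma>" using cont nc by (simp add: smooth_path_iff)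
  have sp: "(t \<le> 1/2 \<longrightarrow> speed A g \<gamma> t = b t * speed A g \<gamma>1 (s1 t)) \<and>
      (1/2 \<le> t \<longrightarrow> speed A g \<gamma> t = b t * speed A g \<gamma>2 (s2 t))" if t: "t \<in> {0..1}" for t
  proof -
    obtain c where c: "c \<in> A" "\<gamma> t \<in> fst c" using chart_at .
    obtain v1 where v1: "\<And>t. t \<in> {0..1} \<Longrightarrow> \<gamma>1 t \<in> fst c \<Longrightarrow> ((snd c \<circ> \<gamma>1) has_vector_derivative v1 t) (at t within {0..1})"
      using smooth_path_velocity[OF \<gamma>(1) c(1)] by metis
    obtain v2 where v2: "\<And>t. t \<in> {0..1} \<Longrightarrow> \<gamma>2 t \<in> fst c \<Longrightarrow> ((snd c \<circ> \<gamma>2) has_vector_derivative v2 t) (at t within {0..1})"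
      using smooth_path_velocity[OF \<gamma>(2) c(1)] by metis
    have i1: "\<gamma>1 (s1 t) = \<gamma> t" if "t \<le> 1/2" using that by (simp add: \<gamma>_eq)
    have t1: "s1 t \<in> {0..1}" "\<gamma>1 (s1 t) \<in> fst c" if "t \<le> 1/2"
      using m1 i1[OF that] that t c(2) by auto
    have t2: "s2 t \<in> {0..1}" "\<gamma>2 (s2 t) \<in> fst c" if "1/2 \<le> t"
      using m2 i2[OF that] that t c(2) by auto
    \<comment> \<open>the velocity of \<open>\<gamma>\<close> in the chart; at the joint both expressions are \<open>0\<close>\<close>
    let ?w = "if t \<le> 1/2 then b t *\<^sub>R v1 (s1 t) else b t *\<^sub>R v2 (s2 t)"
    have "((\<lambda>t. if t \<le> 1/2 then (snd c \<circ> \<gamma>1) (s1 t) else (snd c \<circ> \<gamma>2) (s2 t)) has_vector_derivative ?w)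
        (at t within {0..1})"
    proof (rule has_vector_derivative_cases_le)
      show "((\<lambda>t. (snd c \<circ> \<gamma>1) (s1 t)) has_vector_derivative b t *\<^sub>R v1 (s1 t))
          (at t within {u \<in> {0..1}. u \<le> 1/2})" if "t \<le> 1/2"
        by (rule has_vector_derivative_compose_real[OF s1 v1[OF t1(1)[OF that] t1(2)[OF that]]]) (use m1 in auto)
      show "((\<lambda>t. (snd c \<circ> \<gamma>2) (s2 t)) has_vector_derivative b t *\<^sub>R v2 (s2 t))
          (at t within {u \<in> {0..1}. 1/2 \<le> u})" if "1/2 \<le> t"
        by (rule has_vector_derivative_compose_real[OF s2 v2[OF t2(1)[OF that] t2(2)[OF that]]]) (use m2 in auto)
      show "(snd c \<circ> \<gamma>1) (s1 (1/2)) = (snd c \<circ> \<gamma>2) (s2 (1/2))"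
        unfolding ends by (simp add: joint)
      show "b t *\<^sub>R v1 (s1 t) = b t *\<^sub>R v2 (s2 t)" if "t = 1/2"
        unfolding that by (simp only: b0 scaleR_zero_left)
    qed (use t in auto)
    moreover have "(\<lambda>t. if t \<le> 1/2 then (snd c \<circ> \<gamma>1) (s1 t) else (snd c \<circ> \<gamma>2) (s2 t)) = snd c \<circ> \<gamma>"
      by (auto simp: \<gamma>_eq)
    ultimately have "((snd c \<circ> \<gamma>) has_vector_derivative ?w) (at t within {0..1})" by simp
    from speed_eq[OF cont t c this] have sp: "speed A g \<gamma> t = sqrt (g c (\<gamma> t) ?w ?w)" .
    have r1: "speed A g \<gamma>1 (s1 t) = sqrt (g c (\<gamma> t) (v1 (s1 t)) (v1 (s1 t)))" if "t \<le> 1/2"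
      unfolding i1[OF that, symmetric]
      by (rule speed_eq[OF smooth_path_continuous[OF \<gamma>(1)] t1(1)[OF that] c(1) t1(2)[OF that]
            v1[OF t1(1)[OF that] t1(2)[OF that]]])
    have r2: "speed A g \<gamma>2 (s2 t) = sqrt (g c (\<gamma> t) (v2 (s2 t)) (v2 (s2 t)))" if "1/2 \<le> t"
      unfolding i2[OF that, symmetric]
      by (rule speed_eq[OF smooth_path_continuous[OF \<gamma>(2)] t2(1)[OF that] c(1) t2(2)[OF that]
            v2[OF t2(1)[OF that] t2(2)[OF that]]])
    have q: "sqrt (g c (\<gamma> t) (b t *\<^sub>R v) (b t *\<^sub>R v)) = b t * sqrt (g c (\<gamma> t) v v)" for v
      using bnn by (simp add: g_scale c real_sqrt_mult)
    have z: "b t = 0" if "t = 1/2" unfolding that by (rule b0)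
    have "speed A g \<gamma> t = b t * speed A g \<gamma>1 (s1 t)" if "t \<le> 1/2"
      unfolding sp r1[OF that] q[symmetric] using that by simp
    moreover have "speed A g \<gamma> t = b t * speed A g \<gamma>2 (s2 t)" if "1/2 \<le> t"
    proof (cases "t = 1/2")
      case True
      then show ?thesis using calculation z by simp
    next
      case False
      then show ?thesis unfolding sp r2[OF that] q[symmetric] using that by simp
    qed
    ultimately show ?thesis by blast
  qed
  have 1: "((\<lambda>t. b t *\<^sub>R speed A g \<gamma>1 (s1 t)) has_integral integral {s1 0..s1 (1/2)} (speed A g \<gamma>1)) {0..1/2}"
    by (rule has_integral_substitution[of 0 "1/2" s1 0 1])
      (use m1 ends s1 speed_continuous[OF \<gamma>(1)] in \<open>auto intro: has_field_derivative_at_within\<close>)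
  have 2: "((\<lambda>t. b t *\<^sub>R speed A g \<gamma>2 (s2 t)) has_integral integral {s2 (1/2)..s2 1} (speed A g \<gamma>2)) {1/2..1}"
    by (rule has_integral_substitution[of "1/2" 1 s2 0 1])
      (use m2 ends s2 speed_continuous[OF \<gamma>(2)] in \<open>auto intro: has_field_derivative_at_within\<close>)
  have "(speed A g \<gamma> has_integral riem_length A g \<gamma>1) {0..1/2}"
    using has_integral_eq[OF _ 1, of "speed A g \<gamma>"] sp by (simp add: ends riem_length_def)
  moreover have "(speed A g \<gamma> has_integral riem_length A g \<gamma>2) {1/2..1}"
    using has_integral_eq[OF _ 2, of "speed A g \<gamma>"] sp by (simp add: ends riem_length_def)
  ultimately have "(speed A g \<gamma> has_integral riem_length A g \<gamma>1 + riem_length A g \<gamma>2) {0..1}"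
    by (intro has_integral_combine[of 0 "1/2" 1]) auto
  then show "riem_length A g \<gamma> = riem_length A g \<gamma>1 + riem_length A g \<gamma>2"
    unfolding riem_length_def[of A g \<gamma>] by (rule integral_unique)
qed

lemma integral_speed_constant:
  assumes \<gamma>: "smooth_path A \<gamma>" and ab: "0 \<le> a" "b \<le> 1"
    and const: "\<And>t. t \<in> {a..b} \<Longrightarrow> \<gamma> t = q"
  shows "integral {a..b} (speed A g \<gamma>) = 0"
proof -
  have stop: "speed A g \<gamma> t = 0" if t: "t \<in> {a..b} - {a, b}" for t
  proof -
    have t01: "t \<in> {0..1}" and tab: "t \<in> {a<..<b}" using t ab by auto
    obtain c where c: "c \<in> A" "\<gamma> t \<in> fst c" using chart_at .
    have "((\<lambda>_. snd c q) has_vector_derivative 0) (at t)" by (rule has_vector_derivative_const)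
    then have "((snd c \<circ> \<gamma>) has_vector_derivative 0) (at t)"
      by (rule has_vector_derivative_transform_within_open[OF _ open_greaterThanLessThan tab])
        (use const in auto)
    then have "((snd c \<circ> \<gamma>) has_vector_derivative 0) (at t within {0..1})"
      by (rule has_vector_derivative_at_within)
    from speed_eq[OF smooth_path_continuous[OF \<gamma>] t01 c this] show ?thesis
      using g_scale[OF c, of 0 0] by simp
  qed
  have "(speed A g \<gamma> has_integral 0) {a..b}"
    by (rule has_integral_spike_finite[of "{a, b}", OF _ stop has_integral_0]) auto
  then show ?thesis by (rule integral_unique)
qed

section \<open>Infima of lengths\<close>

lemma path_dist_le:
  "smooth_path A \<gamma> \<Longrightarrow> \<gamma> ` {0..1} \<subseteq> S \<Longrightarrow> path_dist A g S (\<gamma> 0) (\<gamma> 1) \<le> ennreal (riem_length A g \<gamma>)"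
  unfolding path_dist_def by (rule INF_lower) auto

lemma path_dist_lessE:
  assumes "path_dist A g S x y < b"
  obtains \<gamma> where "smooth_path A \<gamma>" "\<gamma> ` {0..1} \<subseteq> S" "\<gamma> 0 = x" "\<gamma> 1 = y"
    "ennreal (riem_length A g \<gamma>) < b"
  using assms unfolding path_dist_def INF_less_iff by blast

text \<open>
  Two almost shortest paths are concatenated.  The error term \<open>e\<close> makes room for the infima, which
  need not be attained.
\<close>

lemma path_dist_triangle:
  "path_dist A g S x z \<le> path_dist A g S x y + path_dist A g S y z"
proof (rule ennreal_le_epsilon)
  fix e :: real assume e: "0 < e" and fin: "path_dist A g S x y + path_dist A g S y z < top"
  then have lt: "path_dist A g S x y < path_dist A g S x y + ennreal (e/2)"
    "path_dist A g S y z < path_dist A g S y z + ennreal (e/2)"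
    by (auto simp: ennreal_add_less_top intro!: ennreal_lessI)
  obtain \<gamma>1 where 1: "smooth_path A \<gamma>1" "\<gamma>1 ` {0..1} \<subseteq> S" "\<gamma>1 0 = x" "\<gamma>1 1 = y"
    "ennreal (riem_length A g \<gamma>1) < path_dist A g S x y + ennreal (e/2)"
    using path_dist_lessE[OF lt(1)] by blast
  obtain \<gamma>2 where 2: "smooth_path A \<gamma>2" "\<gamma>2 ` {0..1} \<subseteq> S" "\<gamma>2 0 = y" "\<gamma>2 1 = z"
    "ennreal (riem_length A g \<gamma>2) < path_dist A g S y z + ennreal (e/2)"
    using path_dist_lessE[OF lt(2)] by blast
  define \<gamma> where "\<gamma> = (\<lambda>t. if t \<le> 1/2 then \<gamma>1 (2 * flatten t) else \<gamma>2 (2 * flatten t - 1))"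
  have "\<gamma>1 1 = \<gamma>2 0" using 1 2 by simp
  note c = riem_length_concat[OF 1(1) 2(1) this, folded \<gamma>_def]
  have ends: "\<gamma> 0 = x" "\<gamma> 1 = z" using 1 2 by (auto simp: \<gamma>_def flatten_simps)
  have "path_dist A g S x z \<le> ennreal (riem_length A g \<gamma>)"
    using path_dist_le[OF c(1), of S] c(3) 1(2) 2(2) unfolding ends by blast
  also have "\<dots> = ennreal (riem_length A g \<gamma>1) + ennreal (riem_length A g \<gamma>2)"
    unfolding c(2) using riem_length_nonneg 1(1) 2(1) by (simp add: ennreal_plus)
  also have "\<dots> \<le> (path_dist A g S x y + ennreal (e/2)) + (path_dist A g S y z + ennreal (e/2))"
    using 1(5) 2(5) by (intro add_mono less_imp_le)
  also have "\<dots> = path_dist A g S x y + path_dist A g S y z + (ennreal (e/2) + ennreal (e/2))"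
    by (simp add: ac_simps)
  also have "ennreal (e/2) + ennreal (e/2) = ennreal e"
    using e by (simp add: ennreal_plus[symmetric] del: ennreal_plus)
  finally show "path_dist A g S x z \<le> path_dist A g S x y + path_dist A g S y z + ennreal e" .
qed

lemma path_dist_commute: "path_dist A g S x y = path_dist A g S y x"
proof -
  have "path_dist A g S y x \<le> path_dist A g S x y" for x y
    unfolding path_dist_def[of A g S x y]
  proof (rule INF_greatest)
    fix \<gamma> assume "\<gamma> \<in> {\<gamma>. smooth_path A \<gamma> \<and> \<gamma> ` {0..1} \<subseteq> S \<and> \<gamma> 0 = x \<and> \<gamma> 1 = y}"
    then have \<gamma>: "smooth_path A \<gamma>" "\<gamma> ` {0..1} \<subseteq> S" "\<gamma> 0 = x" "\<gamma> 1 = y" by auto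
    have "(\<lambda>t. \<gamma> (1 - t)) ` {0..1} \<subseteq> S" using \<gamma>(2) by auto
    from path_dist_le[OF riem_length_reverse(1)[OF \<gamma>(1)] this]
    show "path_dist A g S y x \<le> ennreal (riem_length A g \<gamma>)"
      using riem_length_reverse(2)[OF \<gamma>(1)] \<gamma>(3,4) by simp
  qed
  from antisym[OF this this] show ?thesis .
qed

text \<open>
  For every \<open>s\<close> let \<open>\<tau> s\<close> be a parameter up to which \<open>\<gamma>\<close> has the proportion \<open>s\<close> of its length.  The
  piece of \<open>\<gamma>\<close> between two of these parameters has positive length, so it is not constant and is
  again a smooth path; its length bounds the distance of its end points.
\<close>

lemma proportional_parametrization:
  assumes \<gamma>: "smooth_path A \<gamma>" "\<gamma> ` {0..1} \<subseteq> S" and len: "0 < riem_length A g \<gamma>"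
  obtains \<sigma> where "\<sigma> 0 = \<gamma> 0" "\<sigma> 1 = \<gamma> 1" "\<sigma> ` {0..1} \<subseteq> S"
    "\<And>s t. 0 \<le> s \<Longrightarrow> s < t \<Longrightarrow> t \<le> 1 \<Longrightarrow>
       path_dist A g S (\<sigma> s) (\<sigma> t) \<le> ennreal ((t - s) * riem_length A g \<gamma>)"
proof -
  define L where "L = riem_length A g \<gamma>"
  define arc where "arc = (\<lambda>t. integral {0..t} (speed A g \<gamma>))"
  have arc_diff: "arc b - arc a = integral {a..b} (speed A g \<gamma>)" if "0 \<le> a" "a \<le> b" "b \<le> 1" for a b
    using Henstock_Kurzweil_Integration.integral_combine[OF that(1,2) speed_integrable[OF \<gamma>(1) order_refl that(3)]]
    by (simp add: arc_def)
  have arc_mono: "arc a \<le> arc b" if "0 \<le> a" "a \<le> b" "b \<le> 1" for a b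
  proof -
    have "0 \<le> integral {a..b} (speed A g \<gamma>)"
      using that by (intro integral_nonneg speed_integrable[OF \<gamma>(1)] speed_nonneg[OF \<gamma>(1)]) auto
    then show ?thesis using arc_diff[OF that] by simp
  qed
  have ends: "arc 0 = 0" "arc 1 = L" by (simp_all add: arc_def L_def riem_length_def)
  have cont: "continuous_on {0..1} arc"
    unfolding arc_def using speed_integrable[OF \<gamma>(1), of 0 1] by (intro indefinite_integral_continuous_1) auto
  have "\<exists>u. 0 \<le> u \<and> u \<le> 1 \<and> arc u = s * L" if "s \<in> {0..1}" for s
  proof -
    have "0 \<le> s * L" "s * L \<le> L" using that len by (auto simp: L_def mult_le_cancel_right2)
    then show ?thesis using IVT'[of arc 0 "s * L" 1] ends cont by auto
  qed
  then obtain \<tau>0 where \<tau>0: "\<And>s. s \<in> {0..1} \<Longrightarrow> 0 \<le> \<tau>0 s \<and> \<tau>0 s \<le> 1 \<and> arc (\<tau>0 s) = s * L"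
    by metis
  \<comment> \<open>the path may stand still at its ends, so the extreme parameters have to be prescribed\<close>
  define \<tau> where "\<tau> = \<tau>0(0 := 0, 1 := 1)"
  have \<tau>: "0 \<le> \<tau> s" "\<tau> s \<le> 1" "arc (\<tau> s) = s * L" if "s \<in> {0..1}" for s
    using \<tau>0[OF that] ends by (auto simp: \<tau>_def)
  define \<sigma> where "\<sigma> = (\<lambda>s. \<gamma> (\<tau> s))"
  have "path_dist A g S (\<sigma> s) (\<sigma> t) \<le> ennreal ((t - s) * L)" if st: "0 \<le> s" "s < t" "t \<le> 1" for s t
  proof -
    let ?a = "\<tau> s" and ?b = "\<tau> t"
    have a: "0 \<le> ?a" "arc ?a = s * L" and b: "?b \<le> 1" "arc ?b = t * L"
      using \<tau>[of s] \<tau>[of t] st by auto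
    have lt: "s * L < t * L" using st len by (simp add: L_def)
    have ab: "?a \<le> ?b"
    proof (rule ccontr)
      assume "\<not> ?a \<le> ?b"
      then have "arc ?b \<le> arc ?a" using \<tau>[of s] \<tau>[of t] st by (intro arc_mono) auto
      then show False using a b lt by simp
    qed
    have int: "integral {?a..?b} (speed A g \<gamma>) = (t - s) * L"
      using arc_diff[OF a(1) ab b(1)] a b by (simp add: algebra_simps)
    have \<alpha>: "(?b - ?a) * u + ?a \<in> {?a..?b}" if "u \<in> {0..1}" for u
      using ab that mult_left_le[of u "?b - ?a"] by auto
    have nc: "\<not> (\<lambda>u. \<gamma> ((?b - ?a) * u + ?a)) constant_on {0..1}"
    proof
      assume "(\<lambda>u. \<gamma> ((?b - ?a) * u + ?a)) constant_on {0..1}"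
      then obtain q where q: "\<And>u. u \<in> {0..1} \<Longrightarrow> \<gamma> ((?b - ?a) * u + ?a) = q"
        by (auto simp: constant_on_def)
      have "\<gamma> w = q" if "w \<in> {?a..?b}" for w
      proof (cases "?a = ?b")
        case True
        then show ?thesis using q[of 0] that by simp
      next
        case False
        then have "(?b - ?a) * ((w - ?a) / (?b - ?a)) + ?a = w" "(w - ?a) / (?b - ?a) \<in> {0..1}"
          using that ab by simp_all
        then show ?thesis using q[of "(w - ?a) / (?b - ?a)"] by simp
      qed
      from integral_speed_constant[OF \<gamma>(1) a(1) b(1) this] have "t * L - s * L = 0"
        unfolding int by (simp only: left_diff_distrib)
      with lt show False by linarith
    qed
    note sub = riem_length_subpath[OF \<gamma>(1) a(1) ab b(1) nc]
    have "(\<lambda>u. \<gamma> ((?b - ?a) * u + ?a)) ` {0..1} \<subseteq> S"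
    proof (rule image_subsetI)
      fix u :: real assume "u \<in> {0..1}"
      then have "(?b - ?a) * u + ?a \<in> {0..1}" using \<alpha>[of u] a(1) b(1) by auto
      then show "\<gamma> ((?b - ?a) * u + ?a) \<in> S" using \<gamma>(2) by blast
    qed
    from path_dist_le[OF sub(1) this] show ?thesis
      unfolding sub(2) int by (simp add: \<sigma>_def)
  qed
  moreover have "\<sigma> 0 = \<gamma> 0" "\<sigma> 1 = \<gamma> 1" by (simp_all add: \<sigma>_def \<tau>_def)
  moreover have "\<sigma> ` {0..1} \<subseteq> S"
  proof (rule image_subsetI)
    fix s :: real assume "s \<in> {0..1}"
    then have "\<tau> s \<in> {0..1}" using \<tau> by simp
    then show "\<sigma> s \<in> S" using \<gamma>(2) by (auto simp: \<sigma>_def)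
  qed
  ultimately show ?thesis using that unfolding L_def by blast
qed

section \<open>Riemannian and coordinate distances\<close>

text \<open>
  The quantitative link between the geometry of \<open>X\<close> and that of its coordinates near \<open>p\<close>: \<open>M\<close>
  bounds Riemannian lengths from above, and \<open>m\<close> bounds them from below.
\<close>
definition comparable :: "('a, 'e) chart \<Rightarrow> 'a \<Rightarrow> real \<Rightarrow> real \<Rightarrow> real \<Rightarrow> bool" where
  "comparable c p r m M \<longleftrightarrow> c \<in> A \<and> p \<in> fst c \<and> 0 < r \<and> 0 < m \<and> 0 < M \<and>
     cball (snd c p) r \<subseteq> snd c ` fst c \<and>
     (\<forall>z\<in>cball (snd c p) r. \<forall>v. m * norm v \<le> sqrt (g c (chart_inv c z) v v) \<and>
        sqrt (g c (chart_inv c z) v v) \<le> M * norm v)"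

text \<open>
  By homogeneity it suffices to compare the norms on unit vectors.  There the square of the Riemannian
  norm is a positive continuous function on the product of a closed ball and the unit sphere, and this
  product is compact.
\<close>
lemma comparable_exists: "\<exists>c r m M. comparable c p r m M"
proof -
  obtain c where c: "c \<in> A" "p \<in> fst c" using chart_at .
  obtain r where r: "0 < r" "cball (snd c p) r \<subseteq> snd c ` fst c"
    using chart(2)[OF c(1)] c(2) by (auto simp: open_contains_cball)
  let ?K = "cball (snd c p) r \<times> sphere (0::'e) 1"
  define F where "F = (\<lambda>(z, v). g c (chart_inv c z) v v)"
  have in_chart: "chart_inv c z \<in> fst c" if "z \<in> cball (snd c p) r" for z
    by (rule chart_inv_in[OF subsetD[OF r(2) that]])
  have F_eq: "F x = (\<Sum>(i,j)\<in>Basis \<times> Basis. (snd x \<bullet> i) * (snd x \<bullet> j) * g c (chart_inv c (fst x)) i j)"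
    if "x \<in> ?K" for x
  proof -
    have "fst x \<in> cball (snd c p) r" using that by (simp add: mem_Times_iff)
    from g_expand[OF c(1) in_chart[OF this], of "snd x" "snd x"]
    show ?thesis unfolding F_def case_prod_beta .
  qed
  have "continuous_on ?K (\<lambda>x. g c (chart_inv c (fst x)) i j)" for i j
    by (rule continuous_on_compose2[OF g_continuous[OF c(1)] continuous_on_fst[OF continuous_on_id]])
      (use r(2) in auto)
  then have "continuous_on ?K
      (\<lambda>x. \<Sum>(i,j)\<in>Basis \<times> Basis. (snd x \<bullet> i) * (snd x \<bullet> j) * g c (chart_inv c (fst x)) i j)"
    unfolding case_prod_beta by (intro continuous_intros)
  then have cont: "continuous_on ?K F" by (subst continuous_on_cong[OF refl F_eq])
  have comp: "compact ?K" by (intro compact_Times compact_cball compact_sphere)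
  obtain b :: 'e where "b \<in> Basis" using nonempty_Basis by blast
  then have ne: "?K \<noteq> {}" using r(1) by (auto intro!: exI[of _ b])
  obtain x where x: "x \<in> ?K" "\<And>y. y \<in> ?K \<Longrightarrow> F x \<le> F y"
    using continuous_attains_inf[OF comp ne cont] by blast
  obtain y where y: "y \<in> ?K" "\<And>x. x \<in> ?K \<Longrightarrow> F x \<le> F y"
    using continuous_attains_sup[OF comp ne cont] by blast
  have pos: "0 < F w" if "w \<in> ?K" for w
  proof -
    have w: "fst w \<in> cball (snd c p) r" "snd w \<noteq> 0"
      using that norm_eq_zero[of "snd w"] by (auto simp: mem_Times_iff simp del: norm_eq_zero)
    from g_pos[OF c(1) in_chart[OF w(1)] w(2)] show ?thesis unfolding F_def case_prod_beta .
  qed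
  have hom: "sqrt (g c (chart_inv c z) v v) = norm v * sqrt (F (z, v /\<^sub>R norm v))"
    if "z \<in> cball (snd c p) r" "v \<noteq> 0" for z v
  proof -
    have "g c (chart_inv c z) v v =
        g c (chart_inv c z) (norm v *\<^sub>R (v /\<^sub>R norm v)) (norm v *\<^sub>R (v /\<^sub>R norm v))"
      using that(2) by simp
    also have "\<dots> = (norm v)^2 * F (z, v /\<^sub>R norm v)"
      unfolding F_def by (simp only: g_scale[OF c(1) in_chart[OF that(1)]] prod.case)
    finally show ?thesis by (simp add: real_sqrt_mult)
  qed
  have "sqrt (F x) * norm v \<le> sqrt (g c (chart_inv c z) v v) \<and>
      sqrt (g c (chart_inv c z) v v) \<le> sqrt (F y) * norm v"
    if z: "z \<in> cball (snd c p) r" for z v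
  proof (cases "v = 0")
    case True
    then show ?thesis using g_scale[OF c(1) in_chart[OF z], of 0 v] by simp
  next
    case False
    then have "(z, v /\<^sub>R norm v) \<in> ?K" using z by simp
    then show ?thesis
      using x(2) y(2) False unfolding hom[OF z False]
      by (auto simp: mult.commute intro!: mult_left_mono)
  qed
  then have "comparable c p r (sqrt (F x)) (sqrt (F y))"
    unfolding comparable_def using c r pos[OF x(1)] pos[OF y(1)] by auto
  then show ?thesis by blast
qed

text \<open>
  The path that is a straight segment in the coordinates has speed at most \<open>M\<close> times its Euclidean
  speed.  The points must differ, because constant paths do not count as smooth paths.
\<close>
lemma chart_segment:
  assumes cmp: "comparable c p r m M" and q: "q \<in> fst c" "snd c q \<in> cball (snd c p) r" "q \<noteq> p"
  shows "rho_X A g p q \<le> ennreal (M * norm (snd c q - snd c p))"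
proof -
  have c: "c \<in> A" "p \<in> fst c" "cball (snd c p) r \<subseteq> snd c ` fst c" "0 < r"
    using cmp by (auto simp: comparable_def)
  define v where "v = snd c q - snd c p"
  define l where "l = (\<lambda>t. snd c p + t *\<^sub>R v)"
  define \<gamma> where "\<gamma> = (\<lambda>t. chart_inv c (l t))"
  have l: "l t \<in> cball (snd c p) r" if "t \<in> {0..1}" for t
  proof -
    have "norm v \<le> r" using q(2) by (simp add: v_def dist_norm norm_minus_commute)
    then have "\<bar>t\<bar> * norm v \<le> r" using that mult_left_le_one_le[of "norm v" "\<bar>t\<bar>"] by auto
    then show ?thesis by (simp add: l_def dist_norm)
  qed
  have \<gamma>_in: "\<gamma> t \<in> fst c" and c\<gamma>: "snd c (\<gamma> t) = l t" if "t \<in> {0..1}" for t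
  proof -
    have z: "l t \<in> snd c ` fst c" using l[OF that] c(3) by (rule subsetD[rotated])
    show "\<gamma> t \<in> fst c" "snd c (\<gamma> t) = l t"
      unfolding \<gamma>_def by (rule chart_inv_in[OF z], rule chart_inv_right[OF c(1) z])
  qed
  have l_cont: "continuous_on S l" for S unfolding l_def by (intro continuous_intros)
  have cont: "continuous_on {0..1} \<gamma>"
    unfolding \<gamma>_def by (rule continuous_on_compose2[OF chart(4)[OF c(1)] l_cont]) (use l c(3) in auto)
  have ends: "\<gamma> 0 = p" "\<gamma> 1 = q"
    using chart_inv_left[OF c(1)] c(2) q(1) by (auto simp: \<gamma>_def l_def v_def)
  have "\<not> \<gamma> constant_on {0..1}"
  proof
    assume "\<gamma> constant_on {0..1}"
    then obtain y where "\<And>t. t \<in> {0..1} \<Longrightarrow> \<gamma> t = y" by (auto simp: constant_on_def)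
    from this[of 0] this[of 1] show False using ends q(3) by simp
  qed
  moreover have "curve_Ck n {t \<in> {0..1}. \<gamma> t \<in> fst d} (snd d \<circ> \<gamma>)" if d: "d \<in> A" for d n
  proof -
    have "snd c p + t *\<^sub>R v \<in> snd c ` (fst c \<inter> fst d)" if "t \<in> {t \<in> {0..1}. \<gamma> t \<in> fst d}" for t
      using \<gamma>_in[of t] c\<gamma>[of t] that by (auto simp: l_def image_iff intro!: bexI[of _ "\<gamma> t"])
    from curve_Ck_along_line[OF transition_smooth[OF c(1) d] this]
    have "curve_Ck n {t \<in> {0..1}. \<gamma> t \<in> fst d} (\<lambda>t. (snd d \<circ> chart_inv c) (snd c p + t *\<^sub>R v))" .
    then show ?thesis by (simp add: \<gamma>_def l_def o_def)
  qed
  ultimately have sp: "smooth_path A \<gamma>" using cont by (simp add: smooth_path_iff)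
  have "speed A g \<gamma> t \<le> M * norm v" if t: "t \<in> {0..1}" for t
  proof -
    have "(l has_vector_derivative v) (at t within {0..1})"
      unfolding l_def by (auto intro!: derivative_eq_intros)
    then have "((snd c \<circ> \<gamma>) has_vector_derivative v) (at t within {0..1})"
      by (rule has_vector_derivative_transform[OF t, rotated]) (simp add: c\<gamma>)
    from speed_eq[OF cont t c(1) \<gamma>_in[OF t] this]
    show ?thesis using cmp l[OF t] by (simp add: comparable_def \<gamma>_def)
  qed
  then have "riem_length A g \<gamma> \<le> integral {0..1} (\<lambda>t::real. M * norm v)"
    unfolding riem_length_def using speed_integrable[OF sp, of 0 1] by (intro integral_le) auto
  then have "riem_length A g \<gamma> \<le> M * norm v" by simp
  then show ?thesis
    using path_dist_le[OF sp, of UNIV] unfolding ends v_def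
    by (meson ennreal_leI order_trans subset_UNIV)
qed

text \<open>
  Otherwise let \<open>t1\<close> be the first time at which the path is outside the coordinate ball of radius
  \<open>\<epsilon>\<close>.  The point \<open>\<gamma> t1\<close> still belongs to the chart, as a limit of points in the preimage of the
  closed ball, which is compact and hence closed in \<open>X\<close>.  Up to \<open>t1\<close> the coordinates move by at least
  \<open>\<epsilon>\<close>, while \<open>m\<close> times their Euclidean speed is at most the Riemannian speed; so the length is at
  least \<open>m \<epsilon>\<close>.
\<close>
lemma short_path_stays:
  assumes cmp: "comparable c p r m M" and \<epsilon>: "0 < \<epsilon>" "\<epsilon> \<le> r"
    and \<gamma>: "smooth_path A \<gamma>" "\<gamma> 0 = p" "riem_length A g \<gamma> < m * \<epsilon>"
  shows "\<gamma> 1 \<in> fst c \<and> snd c (\<gamma> 1) \<in> ball (snd c p) \<epsilon>"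
proof (rule ccontr)
  assume neg: "\<not> ?thesis"
  have c: "c \<in> A" "p \<in> fst c" "cball (snd c p) r \<subseteq> snd c ` fst c" "0 < r" "0 < m"
    using cmp by (auto simp: comparable_def)
  note cont = smooth_path_continuous[OF \<gamma>(1)]
  let ?V = "{x \<in> fst c. snd c x \<in> ball (snd c p) \<epsilon>}"
  define B where "B = {t \<in> {0..1}. \<gamma> t \<in> - ?V}"
  have "open ?V" by (rule open_chart_preimage[OF c(1) open_ball])
  then have "closed B" unfolding B_def
    using continuous_closed_preimage[OF cont closed_atLeastAtMost, of "- ?V"]
    by (simp add: vimage_def Int_def closed_Compl)
  moreover have "1 \<in> B" using neg by (simp add: B_def)
  moreover have "bdd_below B" by (auto simp: B_def intro!: bdd_belowI[of _ 0])
  ultimately have inf_B: "Inf B \<in> B" by (intro closed_contains_Inf) auto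
  define t1 where "t1 = Inf B"
  have t1: "t1 \<in> {0..1}" "\<gamma> t1 \<notin> ?V" using inf_B by (auto simp: B_def t1_def)
  have before: "\<gamma> t \<in> ?V" if "0 \<le> t" "t < t1" for t
  proof (rule ccontr)
    assume "\<gamma> t \<notin> ?V"
    then have "t \<in> B" using that t1(1) by (simp add: B_def)
    then have "t1 \<le> t" unfolding t1_def by (rule cInf_lower) (auto simp: B_def intro!: bdd_belowI[of _ 0])
    then show False using that by simp
  qed
  have "0 < t1" using t1 \<gamma>(2) c(2) \<epsilon>(1) by (cases "t1 = 0") auto
  define C where "C = chart_inv c ` cball (snd c p) \<epsilon>"
  have "cball (snd c p) \<epsilon> \<subseteq> snd c ` fst c"
    by (rule order_trans[OF subset_cball[OF \<epsilon>(2)] c(3)])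
  then have "compact C" unfolding C_def
    by (intro compact_continuous_image[OF continuous_on_subset[OF chart(4)[OF c(1)]]] compact_cball)
  then have "closed C" by (rule compact_imp_closed)
  have VC: "?V \<subseteq> C"
  proof
    fix x assume "x \<in> ?V"
    then show "x \<in> C" unfolding C_def
      using chart_inv_left[OF c(1), of x] by (intro image_eqI[of _ _ "snd c x"]) auto
  qed
  have "\<gamma> t1 \<in> C"
  proof (rule Lim_in_closed_set[OF \<open>closed C\<close>])
    have "(\<gamma> \<longlongrightarrow> \<gamma> t1) (at t1 within {0..1})"
      using cont t1(1) by (simp add: continuous_on_def)
    then show "(\<gamma> \<longlongrightarrow> \<gamma> t1) (at t1 within {0..<t1})"
      by (rule tendsto_within_subset) (use t1(1) in auto)
    show "\<forall>\<^sub>F t in at t1 within {0..<t1}. \<gamma> t \<in> C"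
      using before VC by (auto simp: eventually_at_filter intro!: always_eventually)
    show "at t1 within {0..<t1} \<noteq> bot"
      using \<open>0 < t1\<close> by (simp add: trivial_limit_within islimpt_Ico)
  qed
  then obtain z1 where z1: "z1 \<in> cball (snd c p) \<epsilon>" "\<gamma> t1 = chart_inv c z1" by (auto simp: C_def)
  have z1_in: "z1 \<in> snd c ` fst c" using z1(1) c(3) \<epsilon>(2) by auto
  have t1_in: "\<gamma> t1 \<in> fst c" "snd c (\<gamma> t1) = z1"
    unfolding z1(2) by (rule chart_inv_in[OF z1_in], rule chart_inv_right[OF c(1) z1_in])
  then have dist1: "\<epsilon> \<le> norm (z1 - snd c p)"
    using t1(2) by (simp add: dist_norm norm_minus_commute)
  have inside: "\<gamma> t \<in> fst c \<and> snd c (\<gamma> t) \<in> cball (snd c p) r" if "t \<in> {0..t1}" for t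
  proof (cases "t = t1")
    case True
    then show ?thesis using t1_in z1(1) \<epsilon>(2) by auto
  next
    case False
    then have "\<gamma> t \<in> ?V" using before that by auto
    then show ?thesis using \<epsilon>(2) by auto
  qed
  obtain v where v: "continuous_on {t\<in>{0..1}. \<gamma> t \<in> fst c} v"
    "\<And>t. t \<in> {0..1} \<Longrightarrow> \<gamma> t \<in> fst c \<Longrightarrow> ((snd c \<circ> \<gamma>) has_vector_derivative v t) (at t within {0..1})"
    using smooth_path_velocity[OF \<gamma>(1) c(1)] by blast
  have "(v has_integral ((snd c \<circ> \<gamma>) t1 - (snd c \<circ> \<gamma>) 0)) {0..t1}"
  proof (rule fundamental_theorem_of_calculus)
    show "((snd c \<circ> \<gamma>) has_vector_derivative v t) (at t within {0..t1})" if "t \<in> {0..t1}" for t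
      by (rule has_vector_derivative_within_subset[OF v(2)]) (use that t1(1) inside[OF that] in auto)
  qed (use \<open>0 < t1\<close> in simp)
  then have vint: "v integrable_on {0..t1}" "integral {0..t1} v = z1 - snd c p"
    using t1_in \<gamma>(2) by (auto simp: has_integral_iff)
  have le: "norm (v t) \<le> speed A g \<gamma> t / m" if "t \<in> {0..t1}" for t
  proof -
    have t: "t \<in> {0..1}" using that t1(1) by auto
    have "m * norm (v t) \<le> sqrt (g c (chart_inv c (snd c (\<gamma> t))) (v t) (v t))"
      using cmp inside[OF that] by (simp add: comparable_def)
    also have "\<dots> = speed A g \<gamma> t"
      using speed_eq[OF cont t c(1) _ v(2)[OF t]] inside[OF that] chart_inv_left[OF c(1)] by simp
    finally show ?thesis using c(5) by (simp add: field_simps)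
  qed
  have sint: "speed A g \<gamma> integrable_on {0..t1}"
    using speed_integrable[OF \<gamma>(1), of 0 t1] t1(1) by simp
  have "norm (integral {0..t1} v) \<le> integral {0..t1} (\<lambda>t. speed A g \<gamma> t / m)"
    using vint(1) sint le by (intro integral_norm_bound_integral) (auto intro: integrable_on_divide)
  also have "\<dots> = integral {0..t1} (speed A g \<gamma>) / m" by simp
  also have "\<dots> \<le> riem_length A g \<gamma> / m"
    unfolding riem_length_def
    using t1(1) sint speed_integrable[OF \<gamma>(1), of 0 1] speed_nonneg[OF \<gamma>(1)] c(5)
    by (intro divide_right_mono integral_subset_le) auto
  also have "\<dots> < \<epsilon>" using \<gamma>(3) c(5) by (simp add: field_simps)
  finally show False using dist1 vint(2) by simp
qed

lemma near_in_chart: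
  assumes cmp: "comparable c p r m M" and \<epsilon>: "0 < \<epsilon>" "\<epsilon> \<le> r"
    and "rho_X A g p q < ennreal (m * \<epsilon>)"
  shows "q \<in> fst c" "snd c q \<in> ball (snd c p) \<epsilon>"
proof -
  obtain \<gamma> where \<gamma>: "smooth_path A \<gamma>" "\<gamma> 0 = p" "\<gamma> 1 = q" "ennreal (riem_length A g \<gamma>) < ennreal (m * \<epsilon>)"
    using path_dist_lessE[OF assms(4)] by blast
  have "riem_length A g \<gamma> < m * \<epsilon>"
    using \<gamma>(4) riem_length_nonneg[OF \<gamma>(1)] by (simp add: ennreal_less_iff)
  from short_path_stays[OF cmp \<epsilon> \<gamma>(1,2) this] show "q \<in> fst c" "snd c q \<in> ball (snd c p) \<epsilon>"
    using \<gamma>(3) by auto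
qed

text \<open>
  The definition of \<open>path_dist\<close> does not admit constant paths, so this takes short closed paths: a
  small coordinate segment is run forth and back.
\<close>
lemma rho_X_self: "rho_X A g p p = 0"
proof -
  obtain c r m M where cmp: "comparable c p r m M" using comparable_exists by blast
  then have c: "c \<in> A" "p \<in> fst c" "cball (snd c p) r \<subseteq> snd c ` fst c" "0 < r" "0 < M"
    by (auto simp: comparable_def)
  have eps: "rho_X A g p p \<le> 0 + ennreal e" if "0 < e" for e
  proof -
    obtain b :: 'e where b: "b \<in> Basis" using nonempty_Basis by blast
    define \<delta> where "\<delta> = min r (e / (2 * M))"
    have \<delta>: "0 < \<delta>" "\<delta> \<le> r" "2 * (M * \<delta>) \<le> e"
      using c that by (auto simp: \<delta>_def min_def field_simps)
    define z where "z = snd c p + \<delta> *\<^sub>R b"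
    have z: "z \<in> cball (snd c p) r" "z \<noteq> snd c p" "norm (z - snd c p) = \<delta>"
      using \<delta> b by (auto simp: z_def dist_norm)
    define q where "q = chart_inv c z"
    have q: "q \<in> fst c" "snd c q = z"
      using subsetD[OF c(3) z(1)] chart_inv_in chart_inv_right[OF c(1)] by (simp_all add: q_def)
    have pq: "rho_X A g p q \<le> ennreal (M * \<delta>)"
      using chart_segment[OF cmp q(1)] q z by auto
    have "rho_X A g p p \<le> rho_X A g p q + rho_X A g q p" by (rule path_dist_triangle)
    also have "\<dots> \<le> ennreal (M * \<delta>) + ennreal (M * \<delta>)"
      using pq by (intro add_mono) (simp_all add: path_dist_commute)
    also have "\<dots> = ennreal (2 * (M * \<delta>))"
      using c \<delta> by (simp add: ennreal_plus[symmetric] del: ennreal_plus)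
    also have "\<dots> \<le> ennreal e" using \<delta> by (intro ennreal_leI)
    finally show ?thesis by simp
  qed
  have "rho_X A g p p \<le> 0" by (rule ennreal_le_epsilon) (rule eps)
  then show ?thesis by simp
qed

lemma rho_X_le_chart:
  assumes cmp: "comparable c p r m M" and q: "q \<in> fst c" "snd c q \<in> cball (snd c p) r"
  shows "rho_X A g p q \<le> ennreal (M * norm (snd c q - snd c p))"
  using chart_segment[OF assms] rho_X_self by (cases "q = p") auto

end

section \<open>Compactness of Lipschitz families of curves\<close>

text \<open>
  The set \<open>G\<close> of all times at which the values are totally bounded is both open and closed in the unit
  interval.  It is closed because the values at nearby times are uniformly close.  It is open because,
  by completeness, totally bounded values lie in a compact set, and a finite cover by balls inside
  compact sets shows that a whole neighbourhood of it is still totally bounded.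
\<close>

lemma (in Metric_space) equi_Lipschitz_mtotally_bounded:
  fixes \<sigma> :: "nat \<Rightarrow> real \<Rightarrow> 'a"
  assumes complete: "mcomplete"
    and loc: "\<And>x. x \<in> M \<Longrightarrow> \<exists>e>0. \<exists>C. compactin mtopology C \<and> mball x e \<subseteq> C"
    and in_M: "\<And>n s. s \<in> {0..1} \<Longrightarrow> \<sigma> n s \<in> M"
    and lip: "\<And>n s t. s \<in> {0..1} \<Longrightarrow> t \<in> {0..1} \<Longrightarrow> d (\<sigma> n s) (\<sigma> n t) \<le> K * \<bar>s - t\<bar>"
    and K: "0 < K"
    and start: "mtotally_bounded (range (\<lambda>n. \<sigma> n 0))" and s: "s \<in> {0..1}"
  shows "mtotally_bounded (range (\<lambda>n. \<sigma> n s))"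
proof -
  define G where "G = {s \<in> {0..1}. mtotally_bounded (range (\<lambda>n. \<sigma> n s))}"
  have step: "\<exists>\<delta>>0. \<forall>s'\<in>{0..1}. dist s' s < \<delta> \<longrightarrow> s' \<in> G" if "s \<in> G" for s
  proof -
    have s: "s \<in> {0..1}" and tb: "mtotally_bounded (range (\<lambda>n. \<sigma> n s))" using that by (auto simp: G_def)
    let ?C = "mtopology closure_of (range (\<lambda>n. \<sigma> n s))"
    have sub: "range (\<lambda>n. \<sigma> n s) \<subseteq> M" and comp: "compactin mtopology ?C"
      using tb mtotally_bounded_eq_compact_closure_of[OF complete] by auto
    have CM: "?C \<subseteq> M" using comp compactin_subset_topspace by fastforce
    obtain e C where eC: "\<And>x. x \<in> M \<Longrightarrow> 0 < e x \<and> compactin mtopology (C x) \<and> mball x (e x) \<subseteq> C x"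
      using loc by metis
    have "\<exists>\<F>. finite \<F> \<and> \<F> \<subseteq> (\<lambda>x. mball x (e x / 2)) ` ?C \<and> ?C \<subseteq> \<Union>\<F>"
    proof (rule compactinD[OF comp])
      show "?C \<subseteq> \<Union> ((\<lambda>x. mball x (e x / 2)) ` ?C)"
      proof
        fix x assume "x \<in> ?C"
        moreover have "x \<in> mball x (e x / 2)" using \<open>x \<in> ?C\<close> CM eC by force
        ultimately show "x \<in> \<Union> ((\<lambda>x. mball x (e x / 2)) ` ?C)" by blast
      qed
    qed auto
    then obtain \<F> where \<F>: "finite \<F>" "\<F> \<subseteq> (\<lambda>x. mball x (e x / 2)) ` ?C" "?C \<subseteq> \<Union>\<F>" by blast
    obtain F where F': "F \<subseteq> ?C" "finite F" "\<F> = (\<lambda>x. mball x (e x / 2)) ` F"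
      using finite_subset_image[OF \<F>(1,2)] by blast
    have F: "finite F" "F \<subseteq> ?C" "?C \<subseteq> (\<Union>x\<in>F. mball x (e x / 2))"
      using F' \<F>(3) by simp_all
    have FM: "F \<subseteq> M" using F(2) CM by blast
    define \<delta> where "\<delta> = Min (insert 1 (e ` F)) / (2 * K)"
    have "0 < Min (insert 1 (e ` F))"
      using F(1) FM eC by (subst Min_gr_iff) auto
    then have "0 < \<delta>" using K by (simp add: \<delta>_def)
    moreover have "s' \<in> G" if s': "s' \<in> {0..1}" "dist s' s < \<delta>" for s'
    proof -
      have "mtotally_bounded (\<Union> (C ` F))"
        using F(1) FM eC by (intro mtotally_bounded_Union) (auto intro: compactin_imp_mtotally_bounded)
      moreover have "range (\<lambda>n. \<sigma> n s') \<subseteq> \<Union> (C ` F)"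
      proof (rule image_subsetI)
        fix n
        have "\<sigma> n s \<in> ?C" using closure_of_subset[of "range (\<lambda>n. \<sigma> n s)" mtopology] sub by auto
        then obtain x where x: "x \<in> F" "d x (\<sigma> n s) < e x / 2" using F(3) by auto
        have "\<delta> \<le> e x / (2 * K)"
          unfolding \<delta>_def using K F(1) x(1) by (intro divide_right_mono Min_le) auto
        then have "K * \<delta> \<le> e x / 2" using K by (simp add: field_simps)
        moreover have "d (\<sigma> n s) (\<sigma> n s') \<le> K * \<bar>s - s'\<bar>" by (rule lip[OF s s'(1)])
        moreover have "K * \<bar>s - s'\<bar> < K * \<delta>" using s'(2) K by (simp add: dist_real_def abs_minus_commute)
        moreover have "d x (\<sigma> n s') \<le> d x (\<sigma> n s) + d (\<sigma> n s) (\<sigma> n s')"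
          using x(1) FM in_M s s'(1) by (intro triangle) auto
        ultimately have "d x (\<sigma> n s') < e x" using x(2) by linarith
        then have "\<sigma> n s' \<in> mball x (e x)" using x(1) FM in_M s'(1) by auto
        then show "\<sigma> n s' \<in> \<Union> (C ` F)" using eC x(1) FM by blast
      qed
      ultimately show ?thesis using s'(1) mtotally_bounded_subset by (simp add: G_def)
    qed
    ultimately show ?thesis by blast
  qed
  have closure: "s \<in> G" if s: "s \<in> {0..1}" and near: "\<And>\<delta>. 0 < \<delta> \<Longrightarrow> \<exists>s'\<in>G. dist s' s < \<delta>" for s
  proof -
    have "\<exists>N. finite N \<and> N \<subseteq> range (\<lambda>n. \<sigma> n s) \<and> range (\<lambda>n. \<sigma> n s) \<subseteq> (\<Union>x\<in>N. mball x \<epsilon>)"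
      if \<epsilon>: "0 < \<epsilon>" for \<epsilon>
    proof -
      obtain s' where s': "s' \<in> G" "dist s' s < \<epsilon> / (3 * K)"
        using near[of "\<epsilon> / (3 * K)"] \<epsilon> K by auto
      have s'01: "s' \<in> {0..1}" using s'(1) by (simp add: G_def)
      obtain N where N: "finite N" "N \<subseteq> range (\<lambda>n. \<sigma> n s')" "range (\<lambda>n. \<sigma> n s') \<subseteq> (\<Union>x\<in>N. mball x (\<epsilon>/3))"
        using s'(1) \<epsilon> unfolding G_def mtotally_bounded_def by (auto dest: spec[of _ "\<epsilon>/3"])
      obtain J where J: "finite J" "N = (\<lambda>n. \<sigma> n s') ` J"
        using finite_subset_image[OF N(1,2)] by blast
      have close: "d (\<sigma> n s) (\<sigma> n s') < \<epsilon>/3" for n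
      proof -
        have "d (\<sigma> n s) (\<sigma> n s') \<le> K * \<bar>s - s'\<bar>" by (rule lip[OF s s'01])
        also have "\<dots> < \<epsilon>/3" using s'(2) K by (simp add: dist_real_def abs_minus_commute field_simps)
        finally show ?thesis .
      qed
      have "\<sigma> n s \<in> (\<Union>x\<in>(\<lambda>n. \<sigma> n s) ` J. mball x \<epsilon>)" for n
      proof -
        have "\<sigma> n s' \<in> (\<Union>x\<in>N. mball x (\<epsilon>/3))" using N(3) by blast
        then obtain j where j: "j \<in> J" "d (\<sigma> j s') (\<sigma> n s') < \<epsilon>/3" unfolding J(2) by auto
        have "d (\<sigma> j s) (\<sigma> n s) \<le> d (\<sigma> j s) (\<sigma> j s') + d (\<sigma> j s') (\<sigma> n s)"
          by (intro triangle in_M s s'01)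
        also have "d (\<sigma> j s') (\<sigma> n s) \<le> d (\<sigma> j s') (\<sigma> n s') + d (\<sigma> n s') (\<sigma> n s)"
          by (intro triangle in_M s s'01)
        finally have "d (\<sigma> j s) (\<sigma> n s) < \<epsilon>"
          using j(2) close[of j] close[of n] commute[of "\<sigma> n s'" "\<sigma> n s"] by linarith
        then show ?thesis using j(1) in_M[OF s] by auto
      qed
      then show ?thesis using J(1) by (intro exI[of _ "(\<lambda>n. \<sigma> n s) ` J"]) auto
    qed
    then show ?thesis using s by (simp add: G_def mtotally_bounded_def)
  qed
  have "openin (top_of_set {0..1}) G"
    unfolding openin_euclidean_subtopology_iff using step by (auto simp: G_def)
  moreover have "openin (top_of_set {0..1}) ({0..1} - G)"
    unfolding openin_euclidean_subtopology_iff
  proof (intro conjI ballI)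
    fix s assume s: "s \<in> {0..1} - G"
    then obtain \<delta> where "0 < \<delta>" "\<And>s'. s' \<in> G \<Longrightarrow> \<not> dist s' s < \<delta>" using closure by blast
    then show "\<exists>e>0. \<forall>x'\<in>{0..1}. dist x' s < e \<longrightarrow> x' \<in> {0..1} - G" by blast
  qed auto
  then have "closedin (top_of_set {0..1}) G"
    by (auto simp: closedin_def G_def)
  moreover have "0 \<in> G" using start by (simp add: G_def)
  ultimately have "G = {0..1}"
    using connected_Icc[of 0 "1::real"] unfolding connected_clopen by blast
  with s have "s \<in> G" by simp
  then show ?thesis by (simp add: G_def)
qed

text \<open>
  By Tychonoff's theorem the functions \<open>\<sigma> n\<close> lie in a compact subset of the function space.  A cluster
  point in the product topology replaces the diagonal sequences of the Arzela-Ascoli theorem; two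
  coordinates at a time are all that a statement about distances needs.
\<close>

lemma pointwise_cluster_function:
  fixes \<sigma> :: "nat \<Rightarrow> 's \<Rightarrow> 'b::topological_space"
  assumes "\<And>s. \<exists>C. compact C \<and> range (\<lambda>n. \<sigma> n s) \<subseteq> C"
  obtains \<gamma> where "\<And>s t U. open U \<Longrightarrow> (\<gamma> s, \<gamma> t) \<in> U \<Longrightarrow> \<exists>\<^sub>F n in sequentially. (\<sigma> n s, \<sigma> n t) \<in> U"
proof -
  obtain C where C: "\<And>s. compact (C s)" "\<And>s n. \<sigma> n s \<in> C s"
    using assms by (metis rangeI subsetD)
  have "compactin (product_topology (\<lambda>_::'s. euclidean) UNIV) (PiE UNIV C)"
    unfolding compactin_PiE using C(1) by simp
  then have "compact (PiE UNIV C)" by (simp add: euclidean_product_topology)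
  moreover have "filtermap \<sigma> sequentially \<noteq> bot" by (simp add: filtermap_bot_iff)
  moreover have "eventually (\<lambda>f. f \<in> PiE UNIV C) (filtermap \<sigma> sequentially)"
    using C(2) by (simp add: eventually_filtermap PiE_iff)
  ultimately obtain \<gamma> where \<gamma>: "inf (nhds \<gamma>) (filtermap \<sigma> sequentially) \<noteq> bot"
    unfolding compact_filter by blast
  have "\<exists>\<^sub>F n in sequentially. (\<sigma> n s, \<sigma> n t) \<in> U" if U: "open U" "(\<gamma> s, \<gamma> t) \<in> U" for s t U
  proof (rule ccontr)
    assume "\<not> ?thesis"
    then have 1: "eventually (\<lambda>f. (f s, f t) \<notin> U) (filtermap \<sigma> sequentially)"
      by (simp add: frequently_def eventually_filtermap)
    have "continuous_on UNIV (\<lambda>f::'s \<Rightarrow> 'b. (f s, f t))"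
      by (intro continuous_on_Pair continuous_on_product_coordinates)
    then have "open ((\<lambda>f::'s \<Rightarrow> 'b. (f s, f t)) -` U)"
      using U(1) by (rule open_vimage[rotated])
    then have "eventually (\<lambda>f. (f s, f t) \<in> U) (nhds \<gamma>)"
      using U(2) by (auto simp: eventually_nhds vimage_def)
    then have "eventually (\<lambda>f. False) (inf (nhds \<gamma>) (filtermap \<sigma> sequentially))"
      using 1 by (auto simp: eventually_inf)
    then show False using \<gamma> by (simp add: trivial_limit_def)
  qed
  then show ?thesis using that by blast
qed

section \<open>Shortest paths in the metric of a submanifold\<close>

text \<open>
  A strict inequality for one pair of parameters would, by the triangle inequality for \<open>x\<close>, \<open>\<gamma> s\<close>,
  \<open>\<gamma> t\<close>, \<open>y\<close>, make the distance from \<open>x\<close> to \<open>y\<close> smaller than itself.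
\<close>

lemma shortest_pathI:
  fixes \<gamma> :: "real \<Rightarrow> 'a::topological_space"
  assumes i: "cond_i A g Y" and ii: "cond_ii A g Y" and xy: "x \<noteq> y"
    and \<gamma>: "continuous_on {0..1} \<gamma>" "\<gamma> ` {0..1} \<subseteq> Y" "\<gamma> 0 = x" "\<gamma> 1 = y"
    and le: "\<And>s t. 0 \<le> s \<Longrightarrow> s < t \<Longrightarrow> t \<le> 1 \<Longrightarrow>
       rho_Y A g Y (\<gamma> s) (\<gamma> t) \<le> ennreal (t - s) * rho_Y A g Y x y"
  shows "shortest_path A g Y x y \<gamma>"
proof -
  define r where "r = (\<lambda>x y. enn2real (rho_Y A g Y x y))"
  interpret R: Metric_space Y r using ii by (simp add: cond_ii_def r_def)
  have Y: "\<gamma> t \<in> Y" if "0 \<le> t" "t \<le> 1" for t using \<gamma>(2) that by auto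
  have rho: "rho_Y A g Y u v = ennreal (r u v)" if "u \<in> Y" "v \<in> Y" for u v
    using i that by (simp add: cond_i_def r_def)
  have xyY: "x \<in> Y" "y \<in> Y" using Y[of 0] Y[of 1] \<gamma>(3,4) by auto
  have le': "r (\<gamma> s) (\<gamma> t) \<le> (t - s) * r x y" if st: "0 \<le> s" "s \<le> t" "t \<le> 1" for s t
  proof (cases "s = t")
    case True
    then show ?thesis using Y[of t] st by simp
  next
    case False
    then have "ennreal (r (\<gamma> s) (\<gamma> t)) \<le> ennreal ((t - s) * r x y)"
      using le[of s t] st Y[of s] Y[of t] xyY by (simp add: rho ennreal_mult)
    then show ?thesis using st by (subst (asm) ennreal_le_iff) auto
  qed
  have "rho_Y A g Y (\<gamma> s) (\<gamma> t) = ennreal (t - s) * rho_Y A g Y x y" if st: "0 \<le> s" "s < t" "t \<le> 1" for s t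
  proof -
    have "r x y \<le> r x (\<gamma> s) + r (\<gamma> s) y" "r (\<gamma> s) y \<le> r (\<gamma> s) (\<gamma> t) + r (\<gamma> t) y"
      using xyY Y[of s] Y[of t] st by (auto intro: R.triangle)
    moreover have "r x (\<gamma> s) \<le> s * r x y" "r (\<gamma> t) y \<le> (1 - t) * r x y"
      using le'[of 0 s] le'[of t 1] st \<gamma>(3,4) by auto
    ultimately have "(t - s) * r x y \<le> r (\<gamma> s) (\<gamma> t)" by (simp add: algebra_simps)
    then have "r (\<gamma> s) (\<gamma> t) = (t - s) * r x y" using le'[of s t] st by simp
    then show ?thesis using st Y[of s] Y[of t] xyY by (simp add: rho ennreal_mult)
  qed
  then show ?thesis using xy \<gamma> by (simp add: shortest_path_def)
qed

text \<open>
  The two paths are run during \<open>[0, k]\<close> and \<open>[k, 1]\<close>.  The distances split in the ratio \<open>k : 1 - k\<close>, so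
  both have the constant speed that is required of a shortest path from \<open>x\<close> to \<open>y\<close>; for parameters on
  different sides of \<open>k\<close> the triangle inequality through \<open>z\<close> gives the bound.
\<close>

lemma shortest_path_join:
  fixes \<gamma>1 \<gamma>2 :: "real \<Rightarrow> 'a::topological_space"
  assumes i: "cond_i A g Y" and ii: "cond_ii A g Y"
    and \<gamma>1: "shortest_path A g Y x z \<gamma>1" and \<gamma>2: "shortest_path A g Y z y \<gamma>2"
    and xy: "x \<noteq> y" and lam: "0 < k" "k < 1"
    and split: "rho_Y A g Y x z = ennreal k * rho_Y A g Y x y"
      "rho_Y A g Y z y = ennreal (1 - k) * rho_Y A g Y x y"
  obtains \<gamma> where "shortest_path A g Y x y \<gamma>" "\<gamma> k = z"
proof -
  define r where "r = (\<lambda>x y. enn2real (rho_Y A g Y x y))"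
  interpret R: Metric_space Y r using ii by (simp add: cond_ii_def r_def)
  have rho: "rho_Y A g Y u v = ennreal (r u v)" if "u \<in> Y" "v \<in> Y" for u v
    using i that by (simp add: cond_i_def r_def)
  have 1: "continuous_on {0..1} \<gamma>1" "\<gamma>1 ` {0..1} \<subseteq> Y" "\<gamma>1 0 = x" "\<gamma>1 1 = z"
    and 2: "continuous_on {0..1} \<gamma>2" "\<gamma>2 ` {0..1} \<subseteq> Y" "\<gamma>2 0 = z" "\<gamma>2 1 = y"
    using \<gamma>1 \<gamma>2 by (auto simp: shortest_path_def)
  have xyz: "x \<in> Y" "y \<in> Y" "z \<in> Y" using 1 2 by force+
  define L where "L = r x y"
  have L: "0 \<le> L" by (simp add: L_def)
  have rsplit: "r x z = k * L" "r z y = (1 - k) * L"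
    unfolding L_def using split lam by (simp_all add: r_def enn2real_mult)
  define \<gamma> where "\<gamma> = (\<lambda>t. if t \<le> k then \<gamma>1 (t / k) else \<gamma>2 ((t - k) / (1 - k)))"
  have m1: "t / k \<in> {0..1}" if "0 \<le> t" "t \<le> k" for t using that lam by (auto simp: field_simps)
  have m2: "(t - k) / (1 - k) \<in> {0..1}" if "k \<le> t" "t \<le> 1" for t
    using that lam by (auto simp: field_simps)
  have \<gamma>1_eq: "\<gamma> t = \<gamma>1 (t / k)" if "t \<le> k" for t using that by (simp add: \<gamma>_def)
  have \<gamma>2_eq: "\<gamma> t = \<gamma>2 ((t - k) / (1 - k))" if "k \<le> t" for t
    using that lam 1(4) 2(3) by (cases "t = k") (auto simp: \<gamma>_def)
  have mid: "\<gamma> k = z" using lam 1(4) by (simp add: \<gamma>_def)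
  have ends: "\<gamma> 0 = x" "\<gamma> 1 = y" using lam 1(3) 2(4) by (auto simp: \<gamma>_def)
  have Y: "\<gamma> t \<in> Y" if "0 \<le> t" "t \<le> 1" for t
  proof (cases "t \<le> k")
    case True
    then show ?thesis using 1(2) m1[of t] that by (auto simp: \<gamma>1_eq)
  next
    case False
    then show ?thesis using 2(2) m2[of t] that by (auto simp: \<gamma>2_eq)
  qed
  have cont: "continuous_on {0..1} \<gamma>"
    unfolding \<gamma>_def
  proof (rule continuous_on_cases_le)
    show "continuous_on {t \<in> {0..1}. t \<le> k} (\<lambda>t. \<gamma>1 (t / k))"
    proof (rule continuous_on_compose2[OF 1(1)])
      show "continuous_on {t \<in> {0..1}. t \<le> k} (\<lambda>t. t / k)" using lam by (intro continuous_intros) auto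
    qed (use m1 in auto)
    show "continuous_on {t \<in> {0..1}. k \<le> t} (\<lambda>t. \<gamma>2 ((t - k) / (1 - k)))"
    proof (rule continuous_on_compose2[OF 2(1)])
      show "continuous_on {t \<in> {0..1}. k \<le> t} (\<lambda>t. (t - k) / (1 - k))"
        using lam by (intro continuous_intros) auto
    qed (use m2 in auto)
    show "\<gamma>1 (t / k) = \<gamma>2 ((t - k) / (1 - k))" if "t = k" for t
      using that lam 1(4) 2(3) by simp
  qed (auto intro: continuous_intros)
  have speed1: "r (\<gamma>1 s) (\<gamma>1 t) = (t - s) * r x z" if "0 \<le> s" "s < t" "t \<le> 1" for s t
    using \<gamma>1 that unfolding shortest_path_def r_def by (simp add: enn2real_mult)
  have speed2: "r (\<gamma>2 s) (\<gamma>2 t) = (t - s) * r z y" if "0 \<le> s" "s < t" "t \<le> 1" for s t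
    using \<gamma>2 that unfolding shortest_path_def r_def by (simp add: enn2real_mult)
  have left: "r (\<gamma> s) (\<gamma> t) = (t - s) * L" if st: "0 \<le> s" "s < t" "t \<le> k" for s t
  proof -
    have "r (\<gamma>1 (s / k)) (\<gamma>1 (t / k)) = (t / k - s / k) * r x z"
      by (rule speed1) (use st lam m1[of s] m1[of t] in \<open>auto simp: divide_strict_right_mono\<close>)
    also have "\<dots> = (t - s) * L" unfolding rsplit using lam by (simp add: field_simps)
    finally show ?thesis using st by (simp add: \<gamma>1_eq)
  qed
  have right: "r (\<gamma> s) (\<gamma> t) = (t - s) * L" if st: "k \<le> s" "s < t" "t \<le> 1" for s t
  proof -
    have "r (\<gamma>2 ((s - k) / (1 - k))) (\<gamma>2 ((t - k) / (1 - k)))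
        = ((t - k) / (1 - k) - (s - k) / (1 - k)) * r z y"
      by (rule speed2) (use st lam m2[of s] m2[of t] in \<open>auto simp: divide_strict_right_mono\<close>)
    also have "\<dots> = (t - s) * L"
      unfolding rsplit diff_divide_distrib[symmetric] using lam by simp
    finally show ?thesis using st by (simp add: \<gamma>2_eq)
  qed
  have "r (\<gamma> s) (\<gamma> t) \<le> (t - s) * L" if st: "0 \<le> s" "s < t" "t \<le> 1" for s t
  proof -
    consider "t \<le> k" | "k \<le> s" | "s < k" "k < t" by linarith
    then show ?thesis
    proof cases
      case 1
      then show ?thesis using left[of s t] st by simp
    next
      case 2
      then show ?thesis using right[of s t] st by simp
    next
      case 3
      have "r (\<gamma> s) (\<gamma> t) \<le> r (\<gamma> s) (\<gamma> k) + r (\<gamma> k) (\<gamma> t)"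
        using st lam by (intro R.triangle Y) auto
      also have "\<dots> = (t - s) * L"
        using left[of s k] right[of k t] 3 st by (simp add: algebra_simps)
      finally show ?thesis .
    qed
  qed
  then have le: "rho_Y A g Y (\<gamma> s) (\<gamma> t) \<le> ennreal (t - s) * rho_Y A g Y x y"
    if st: "0 \<le> s" "s < t" "t \<le> 1" for s t
    using that Y[of s] Y[of t] xyz L
    by (simp add: rho ennreal_mult[symmetric] L_def ennreal_leI)
  have "\<gamma> ` {0..1} \<subseteq> Y" using Y by auto
  from that[OF shortest_pathI[OF i ii xy cont this ends le] mid] show ?thesis .
qed

section \<open>The metric space of a connected Riemannian manifold\<close>

locale connected_riemannian = riemannian A g
  for A :: "('a::{t2_space, second_countable_topology}, 'e::euclidean_space) chart set"
    and g :: "('a, 'e) metric_tensor" +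
  assumes conn: "connected (UNIV :: 'a set)"
begin

definition distance :: "'a \<Rightarrow> 'a \<Rightarrow> real" where
  "distance x y = enn2real (rho_X A g x y)"

text \<open>
  Finiteness of the distance from \<open>p\<close> does not change inside a coordinate ball, so the points at
  finite distance form an open and closed set.
\<close>
lemma rho_X_finite: "rho_X A g p q < \<infinity>"
proof -
  define F where "F = {q. rho_X A g p q < \<infinity>}"
  have nbhd: "\<exists>V. open V \<and> q \<in> V \<and> (\<forall>q'\<in>V. q' \<in> F \<longleftrightarrow> q \<in> F)" for q
  proof -
    obtain c r m M where cmp: "comparable c q r m M" using comparable_exists by blast
    let ?V = "{x \<in> fst c. snd c x \<in> ball (snd c q) r}"
    have fin: "rho_X A g q q' < \<infinity>" if "q' \<in> ?V" for q'
    proof -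
      have "rho_X A g q q' \<le> ennreal (M * norm (snd c q' - snd c q))"
        using that by (intro rho_X_le_chart[OF cmp]) auto
      then show ?thesis by (rule order_le_less_trans) simp
    qed
    have "q' \<in> F \<longleftrightarrow> q \<in> F" if "q' \<in> ?V" for q'
    proof -
      have "rho_X A g p q' \<le> rho_X A g p q + rho_X A g q q'"
        "rho_X A g p q \<le> rho_X A g p q' + rho_X A g q q'"
        using path_dist_triangle[of UNIV p q' q] path_dist_triangle[of UNIV p q q']
        by (simp_all add: path_dist_commute[of UNIV q' q])
      then show ?thesis using fin[OF that] unfolding F_def mem_Collect_eq
        by (metis ennreal_add_less_top infinity_ennreal_def order_le_less_trans)
    qed
    moreover have "open ?V" using cmp by (intro open_chart_preimage) (auto simp: comparable_def)
    moreover have "q \<in> ?V" using cmp by (auto simp: comparable_def)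
    ultimately show ?thesis by blast
  qed
  have "open F"
    by (subst open_subopen) (use nbhd in fast)
  have "open (- F)"
    by (subst open_subopen) (use nbhd in fast)
  then have "F = {} \<or> - F = {}"
    using connectedD[OF conn \<open>open F\<close>, of "- F"] by auto
  moreover have "p \<in> F" by (simp add: F_def rho_X_self)
  ultimately have "q \<in> F" by auto
  then show ?thesis by (simp add: F_def)
qed

lemma ennreal_distance: "ennreal (distance x y) = rho_X A g x y"
  unfolding distance_def using rho_X_finite by simp

lemma distance_le_iff: "0 \<le> e \<Longrightarrow> distance x y \<le> e \<longleftrightarrow> rho_X A g x y \<le> ennreal e"
  unfolding ennreal_distance[symmetric] by (simp add: ennreal_le_iff)

lemma distance_less_iff: "distance x y < e \<longleftrightarrow> rho_X A g x y < ennreal e"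
proof -
  have "0 \<le> distance x y" by (simp add: distance_def)
  then show ?thesis unfolding ennreal_distance[symmetric] by (simp add: ennreal_less_iff)
qed

text \<open>
  Points at distance \<open>0\<close> have coordinates at Euclidean distance less than every \<open>\<epsilon>\<close>, by
  \<open>near_in_chart\<close>.
\<close>
lemma Metric_space_distance: "Metric_space UNIV distance"
proof (rule Metric_space.intro)
  show "0 \<le> distance x y" for x y by (simp add: distance_def)
  show "distance x y = distance y x" for x y by (simp add: distance_def path_dist_commute)
  show "distance x z \<le> distance x y + distance y z" for x y z
  proof -
    have nn: "0 \<le> distance x y" for x y by (simp add: distance_def)
    have "ennreal (distance x z) \<le> ennreal (distance x y + distance y z)"
      unfolding ennreal_plus[OF nn nn] ennreal_distance by (rule path_dist_triangle)
    then show ?thesis using nn by (simp add: ennreal_le_iff del: ennreal_plus)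
  qed
  show "distance x y = 0 \<longleftrightarrow> x = y" for x y
  proof
    assume 0: "distance x y = 0"
    obtain c r m M where cmp: "comparable c x r m M" using comparable_exists by blast
    then have c: "c \<in> A" "x \<in> fst c" "0 < r" "0 < m" by (auto simp: comparable_def)
    have near: "y \<in> fst c" "snd c y \<in> ball (snd c x) \<epsilon>" if "0 < \<epsilon>" "\<epsilon> \<le> r" for \<epsilon>
    proof -
      have "rho_X A g x y < ennreal (m * \<epsilon>)"
        using 0 that c by (simp add: distance_less_iff[symmetric])
      from near_in_chart[OF cmp that this] show "y \<in> fst c" "snd c y \<in> ball (snd c x) \<epsilon>" .
    qed
    have "snd c x = snd c y"
    proof (rule ccontr)
      assume "snd c x \<noteq> snd c y"
      then show False
        using near(2)[of "min r (dist (snd c x) (snd c y))"] c by auto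
    qed
    then show "x = y"
      using chart_inv_left[OF c(1,2)] chart_inv_left[OF c(1) near(1)[OF c(3) order_refl]] by metis
  qed (simp add: distance_def rho_X_self)
qed

interpretation X: Metric_space UNIV distance
  by (rule Metric_space_distance)

text \<open>
  The two inclusions are the two estimates in a chart: small coordinate balls lie in small metric
  balls by \<open>rho_X_le_chart\<close>, and conversely by \<open>near_in_chart\<close>.
\<close>
lemma mtopology_eq: "X.mtopology = euclidean"
proof -
  have "openin X.mtopology U \<longleftrightarrow> open U" for U
  proof
    assume U: "openin X.mtopology U"
    show "open U"
    proof (subst open_subopen, intro ballI)
      fix x assume "x \<in> U"
      then obtain e where e: "0 < e" "X.mball x e \<subseteq> U" using U unfolding X.openin_mtopology by blast
      obtain c r m M where cmp: "comparable c x r m M" using comparable_exists by blast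
      then have c: "c \<in> A" "x \<in> fst c" "0 < r" "0 < M" by (auto simp: comparable_def)
      let ?V = "{y \<in> fst c. snd c y \<in> ball (snd c x) (min r (e / M))}"
      have "open ?V" by (rule open_chart_preimage[OF c(1) open_ball])
      moreover have "x \<in> ?V" using c e by auto
      moreover have "?V \<subseteq> U"
      proof
        fix y assume y: "y \<in> ?V"
        then have "rho_X A g x y \<le> ennreal (M * norm (snd c y - snd c x))"
          by (intro rho_X_le_chart[OF cmp]) auto
        then have "distance x y \<le> M * norm (snd c y - snd c x)"
          using c by (simp add: distance_le_iff)
        also have "\<dots> < e"
          using y c by (simp add: dist_norm norm_minus_commute field_simps)
        finally show "y \<in> U" using e(2) by auto
      qed
      ultimately show "\<exists>T. open T \<and> x \<in> T \<and> T \<subseteq> U" by blast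
    qed
  next
    assume U: "open U"
    show "openin X.mtopology U"
      unfolding X.openin_mtopology
    proof (intro conjI allI impI)
      fix x assume "x \<in> U"
      obtain c r m M where cmp: "comparable c x r m M" using comparable_exists by blast
      then have c: "c \<in> A" "x \<in> fst c" "0 < r" "0 < m" by (auto simp: comparable_def)
      have "open (snd c ` (U \<inter> fst c))"
        by (rule open_chart_image[OF c(1) open_Int[OF U chart(1)[OF c(1)]]]) auto
      moreover have "snd c x \<in> snd c ` (U \<inter> fst c)" using \<open>x \<in> U\<close> c(2) by simp
      ultimately obtain e where e: "0 < e" "ball (snd c x) e \<subseteq> snd c ` (U \<inter> fst c)"
        by (rule openE)
      define \<epsilon> where "\<epsilon> = min e r"
      have \<epsilon>: "0 < \<epsilon>" "\<epsilon> \<le> r" "\<epsilon> \<le> e" using e c by (auto simp: \<epsilon>_def)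
      have "X.mball x (m * \<epsilon>) \<subseteq> U"
      proof
        fix y assume "y \<in> X.mball x (m * \<epsilon>)"
        then have "rho_X A g x y < ennreal (m * \<epsilon>)" by (simp add: distance_less_iff)
        note y = near_in_chart[OF cmp \<epsilon>(1,2) this]
        then have "snd c y \<in> snd c ` (U \<inter> fst c)" using e(2) \<epsilon>(3) by auto
        then obtain u where "u \<in> U" "u \<in> fst c" "snd c u = snd c y" by auto
        then show "y \<in> U" using chart_inv_left[OF c(1), of u] chart_inv_left[OF c(1) y(1)] by metis
      qed
      then show "\<exists>r>0. X.mball x r \<subseteq> U" using c \<epsilon> by (intro exI[of _ "m * \<epsilon>"]) auto
    qed simp
  qed
  then show ?thesis by (simp add: topology_eq)
qed

lemma compact_neighbourhood: "\<exists>e>0. \<exists>C. compactin X.mtopology C \<and> X.mball x e \<subseteq> C"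
proof -
  obtain c r m M where cmp: "comparable c x r m M" using comparable_exists by blast
  then have c: "c \<in> A" "x \<in> fst c" "0 < r" "0 < m" "cball (snd c x) r \<subseteq> snd c ` fst c"
    by (auto simp: comparable_def)
  have "compact (chart_inv c ` cball (snd c x) r)"
    by (rule compact_continuous_image[OF continuous_on_subset[OF chart(4)[OF c(1)] c(5)] compact_cball])
  moreover have "X.mball x (m * r) \<subseteq> chart_inv c ` cball (snd c x) r"
  proof
    fix y assume "y \<in> X.mball x (m * r)"
    then have "rho_X A g x y < ennreal (m * r)" by (simp add: distance_less_iff)
    note y = near_in_chart[OF cmp c(3) order_refl this]
    show "y \<in> chart_inv c ` cball (snd c x) r"
      using chart_inv_left[OF c(1) y(1)] y(2) by (intro image_eqI[of _ _ "snd c y"]) auto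
  qed
  ultimately show ?thesis using c by (intro exI[of _ "m * r"]) (auto simp: mtopology_eq)
qed

section \<open>Existence of shortest paths\<close>

text \<open>
  The approximating paths have length at most \<open>b n = L + 1 / (n + 1)\<close>, and their end points lie in the
  \<open>n\<close>-th set of a neighbourhood basis of \<open>(x, y)\<close>.
\<close>
lemma shortest_path_exists:
  fixes Y :: "'a set"
  assumes complete: "complete_riemannian A g" and closed: "closed Y"
    and i: "cond_i A g Y" and ii: "cond_ii A g Y"
    and xy: "x \<in> Y" "y \<in> Y" "x \<noteq> y"
  shows "\<exists>\<gamma>. shortest_path A g Y x y \<gamma>"
proof -
  define I where "I = mint TYPE('e) Y"
  have IY: "I \<subseteq> Y" by (auto simp: I_def mint_def)
  let ?F = "inf (nhds (x, y)) (principal (I \<times> I))"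
  define f where "f = (\<lambda>(x', y'). path_dist A g I x' y')"
  have rho: "rho_Y A g Y u v = Liminf (inf (nhds (u, v)) (principal (I \<times> I))) f" for u v
    by (simp add: rho_Y_def I_def f_def Let_def)
  define L where "L = enn2real (rho_Y A g Y x y)"
  have L: "rho_Y A g Y x y = ennreal L" "0 \<le> L"
    using i xy by (auto simp: cond_i_def L_def)
  \<comment> \<open>disjoint neighbourhoods keep the end points apart, so that the paths have positive length\<close>
  obtain U V where UV: "open U" "open V" "x \<in> U" "y \<in> V" "U \<inter> V = {}"
    using hausdorff[OF xy(3)] by blast
  obtain W :: "nat \<Rightarrow> ('a \<times> 'a) set" where W: "\<And>n. open (W n)" "\<And>n. (x, y) \<in> W n"
    "\<And>S. open S \<Longrightarrow> (x, y) \<in> S \<Longrightarrow> eventually (\<lambda>n. W n \<subseteq> S) sequentially"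
    by (rule countable_basis_at_decseq[of "(x, y)"]) blast
  define b where "b = (\<lambda>n::nat. L + 1 / (real n + 1))"
  have b: "0 < b n" "b n \<le> L + 1" "L < b n" for n
    using L(2) by (auto simp: b_def field_simps add_pos_nonneg)
  have b_lim: "b \<longlonglongrightarrow> L"
  proof -
    have "(\<lambda>n. L + 1 / (real n + 1)) \<longlonglongrightarrow> L + 0"
      using LIMSEQ_inverse_real_of_nat by (intro tendsto_add tendsto_const) (simp add: inverse_eq_divide add.commute)
    then show ?thesis by (simp add: b_def)
  qed
  have "\<exists>\<sigma>. (\<sigma> 0, \<sigma> 1) \<in> W n \<and> \<sigma> ` {0..1} \<subseteq> I \<and>
      (\<forall>s t. 0 \<le> s \<longrightarrow> s < t \<longrightarrow> t \<le> 1 \<longrightarrow> path_dist A g I (\<sigma> s) (\<sigma> t) \<le> ennreal ((t - s) * b n))" for n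
  proof -
    have "Liminf ?F f < ennreal (b n)"
      using L b[of n] unfolding rho[symmetric] by (simp add: ennreal_lessI)
    then have not_ev: "\<not> eventually (\<lambda>p. ennreal (b n) \<le> f p) ?F"
      using Liminf_bounded[of "ennreal (b n)" f ?F] by auto
    have "\<not> (\<forall>p\<in>W n \<inter> (U \<times> V). p \<in> I \<times> I \<longrightarrow> ennreal (b n) \<le> f p)"
    proof
      assume all: "\<forall>p\<in>W n \<inter> (U \<times> V). p \<in> I \<times> I \<longrightarrow> ennreal (b n) \<le> f p"
      have "open (W n \<inter> (U \<times> V))" by (rule open_Int[OF W(1) open_Times[OF UV(1,2)]])
      moreover have "(x, y) \<in> W n \<inter> (U \<times> V)" using W(2) UV(3,4) by simp
      ultimately have "eventually (\<lambda>p. p \<in> W n \<inter> (U \<times> V)) (nhds (x, y))"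
        by (rule eventually_nhds_in_open)
      then have "eventually (\<lambda>p. ennreal (b n) \<le> f p) ?F"
        unfolding eventually_inf_principal by eventually_elim (use all in blast)
      with not_ev show False by contradiction
    qed
    then obtain x' y' where p: "(x', y') \<in> W n" "x' \<in> U" "y' \<in> V" "path_dist A g I x' y' < ennreal (b n)"
      by (auto simp: f_def not_le)
    obtain \<gamma> where \<gamma>: "smooth_path A \<gamma>" "\<gamma> ` {0..1} \<subseteq> I" "\<gamma> 0 = x'" "\<gamma> 1 = y'"
      "ennreal (riem_length A g \<gamma>) < ennreal (b n)"
      using path_dist_lessE[OF p(4)] by blast
    have len: "riem_length A g \<gamma> \<le> b n"
      using \<gamma>(5) riem_length_nonneg[OF \<gamma>(1)] by (simp add: ennreal_less_iff)
    have "x' \<noteq> y'" using p UV(5) by blast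
    then have "0 < distance x' y'" using X.nonneg[of x' y'] X.zero[of x' y'] by (simp add: less_le)
    also have "distance x' y' \<le> riem_length A g \<gamma>"
      using path_dist_le[OF \<gamma>(1), of UNIV] \<gamma>(3,4) riem_length_nonneg[OF \<gamma>(1)]
      by (simp add: distance_le_iff)
    finally have pos: "0 < riem_length A g \<gamma>" .
    obtain \<sigma> where \<sigma>: "\<sigma> 0 = \<gamma> 0" "\<sigma> 1 = \<gamma> 1" "\<sigma> ` {0..1} \<subseteq> I"
      "\<And>s t. 0 \<le> s \<Longrightarrow> s < t \<Longrightarrow> t \<le> 1 \<Longrightarrow>
         path_dist A g I (\<sigma> s) (\<sigma> t) \<le> ennreal ((t - s) * riem_length A g \<gamma>)"
      using proportional_parametrization[OF \<gamma>(1,2) pos] by blast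
    have "path_dist A g I (\<sigma> s) (\<sigma> t) \<le> ennreal ((t - s) * b n)" if "0 \<le> s" "s < t" "t \<le> 1" for s t
    proof -
      have "(t - s) * riem_length A g \<gamma> \<le> (t - s) * b n" using len that by (intro mult_left_mono) auto
      then show ?thesis using order_trans[OF \<sigma>(4)[OF that] ennreal_leI] by blast
    qed
    moreover have "(\<sigma> 0, \<sigma> 1) \<in> W n" using \<sigma>(1,2) \<gamma>(3,4) p(1) by simp
    ultimately show ?thesis using \<sigma>(3) by blast
  qed
  then obtain \<sigma> where \<sigma>W: "\<And>n. (\<sigma> n 0, \<sigma> n 1) \<in> W n" and \<sigma>I: "\<And>n. \<sigma> n ` {0..1} \<subseteq> I"
    and \<sigma>le: "\<And>n s t. 0 \<le> s \<Longrightarrow> s < t \<Longrightarrow> t \<le> 1 \<Longrightarrow>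
      path_dist A g I (\<sigma> n s) (\<sigma> n t) \<le> ennreal ((t - s) * b n)"
    by metis
  have in_I: "\<sigma> n s \<in> I" if "s \<in> {0..1}" for n s using \<sigma>I[of n] that by blast
  have lim: "eventually (\<lambda>n. (\<sigma> n 0, \<sigma> n 1) \<in> S) sequentially" if "open S" "(x, y) \<in> S" for S
    using W(3)[OF that] by eventually_elim (use \<sigma>W in blast)
  have lip: "distance (\<sigma> n s) (\<sigma> n t) \<le> (L + 1) * \<bar>s - t\<bar>" if st: "s \<in> {0..1}" "t \<in> {0..1}" for n s t
  proof -
    have *: "distance (\<sigma> n s) (\<sigma> n t) \<le> (L + 1) * \<bar>s - t\<bar>" if "0 \<le> s" "s < t" "t \<le> 1" for s t
    proof -
      have "rho_X A g (\<sigma> n s) (\<sigma> n t) \<le> path_dist A g I (\<sigma> n s) (\<sigma> n t)"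
        unfolding path_dist_def by (rule INF_superset_mono) auto
      also have "\<dots> \<le> ennreal ((t - s) * b n)" by (rule \<sigma>le[OF that])
      also have "\<dots> \<le> ennreal ((L + 1) * \<bar>s - t\<bar>)"
        using b(2)[of n] that by (intro ennreal_leI) (simp add: mult.commute mult_left_mono)
      finally show ?thesis using L(2) by (simp add: distance_le_iff)
    qed
    show ?thesis
    proof (cases s t rule: linorder_cases)
      case less
      then show ?thesis using *[of s t] st by simp
    next
      case equal
      then show ?thesis by simp
    next
      case greater
      then show ?thesis using *[of t s] st by (simp add: X.commute abs_minus_commute)
    qed
  qed
  have X_complete: "X.mcomplete"
    using complete by (simp add: complete_riemannian_def distance_def[abs_def])
  have "limitin euclidean (\<lambda>n. \<sigma> n 0) x sequentially"
    unfolding limitin_def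
  proof (intro conjI allI impI)
    fix S assume "openin euclidean S \<and> x \<in> S"
    then have "open (S \<times> UNIV :: ('a \<times> 'a) set)" "(x, y) \<in> S \<times> UNIV" by (auto intro: open_Times)
    from lim[OF this] show "\<forall>\<^sub>F n in sequentially. \<sigma> n 0 \<in> S" by simp
  qed simp
  then have "X.MCauchy (\<lambda>n. \<sigma> n 0)"
    by (intro X.convergent_imp_MCauchy) (auto simp: mtopology_eq)
  then have start: "X.mtotally_bounded (range (\<lambda>n. \<sigma> n 0))"
    by (rule X.mtotally_bounded_cauchy_sequence)
  \<comment> \<open>the cluster point is taken among functions on all of \<open>real\<close>, so the paths are extended by
    constants\<close>
  define clamp where "clamp = (\<lambda>s::real. max 0 (min 1 s))"
  have clamp: "clamp s \<in> {0..1}" for s by (auto simp: clamp_def)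
  have clamp_id: "clamp s = s" if "s \<in> {0..1}" for s using that by (auto simp: clamp_def)
  have "\<exists>C. compact C \<and> range (\<lambda>n. \<sigma> n (clamp s)) \<subseteq> C" for s
  proof -
    have "X.mtotally_bounded (range (\<lambda>n. \<sigma> n (clamp s)))"
    proof (rule X.equi_Lipschitz_mtotally_bounded[where K = "L + 1", OF X_complete])
      show "\<exists>e>0. \<exists>C. compactin X.mtopology C \<and> X.mball x e \<subseteq> C" for x
        by (rule compact_neighbourhood)
      show "distance (\<sigma> n s) (\<sigma> n t) \<le> (L + 1) * \<bar>s - t\<bar>"
        if "s \<in> {0..1}" "t \<in> {0..1}" for n s t by (rule lip[OF that])
      show "X.mtotally_bounded (range (\<lambda>n. \<sigma> n 0))" by (rule start)
      show "clamp s \<in> {0..1}" by (rule clamp)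
    qed (use L(2) in simp_all)
    then have "compact (closure (range (\<lambda>n. \<sigma> n (clamp s))))"
      unfolding X.mtotally_bounded_eq_compact_closure_of[OF X_complete] mtopology_eq by simp
    with closure_subset[of "range (\<lambda>n. \<sigma> n (clamp s))"] show ?thesis
      by (intro exI[of _ "closure (range (\<lambda>n. \<sigma> n (clamp s)))"] conjI)
  qed
  then obtain \<gamma> where cluster: "\<And>s t U. open U \<Longrightarrow> (\<gamma> s, \<gamma> t) \<in> U \<Longrightarrow>
      \<exists>\<^sub>F n in sequentially. (\<sigma> n (clamp s), \<sigma> n (clamp t)) \<in> U"
    by (rule pointwise_cluster_function[of "\<lambda>n s. \<sigma> n (clamp s)"]) blast
  have cluster': "\<exists>\<^sub>F n in sequentially. (\<sigma> n s, \<sigma> n t) \<in> U"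
    if "open U" "(\<gamma> s, \<gamma> t) \<in> U" "s \<in> {0..1}" "t \<in> {0..1}" for s t U
    using cluster[OF that(1,2)] clamp_id that(3,4) by simp
  have \<gamma>Y: "\<gamma> s \<in> Y" if s: "s \<in> {0..1}" for s
  proof (rule ccontr)
    assume "\<gamma> s \<notin> Y"
    then have "\<exists>\<^sub>F n in sequentially. (\<sigma> n s, \<sigma> n s) \<in> (- Y) \<times> (- Y)"
      using closed s by (intro cluster' open_Times) auto
    then obtain n where "\<sigma> n s \<notin> Y" by (auto dest: frequently_ex)
    then show False using in_I[OF s, of n] IY by blast
  qed
  have ends: "\<gamma> 0 = x" "\<gamma> 1 = y"
  proof -
    have "(\<gamma> 0, \<gamma> 1) = (x, y)"
    proof (rule ccontr)
      assume "(\<gamma> 0, \<gamma> 1) \<noteq> (x, y)"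
      from hausdorff[OF this]
      obtain S T where ST: "open S" "open T" "(\<gamma> 0, \<gamma> 1) \<in> S" "(x, y) \<in> T" "S \<inter> T = {}"
        by (elim exE conjE)
      have "\<exists>\<^sub>F n in sequentially. (\<sigma> n 0, \<sigma> n 1) \<in> S" by (rule cluster') (use ST in auto)
      moreover have "\<forall>\<^sub>F n in sequentially. (\<sigma> n 0, \<sigma> n 1) \<notin> S"
        using lim[OF ST(2,4)] by eventually_elim (use ST(5) in blast)
      ultimately show False by (simp add: frequently_def)
    qed
    then show "\<gamma> 0 = x" "\<gamma> 1 = y" by auto
  qed
  \<comment> \<open>bounds for \<open>\<sigma> n\<close> pass to \<open>\<gamma>\<close>: a violation would be an open condition on two values, hence
    shared by some \<open>\<sigma> n\<close>\<close>
  have \<gamma>lip: "distance (\<gamma> s) (\<gamma> t) \<le> (L + 1) * \<bar>s - t\<bar>" if st: "s \<in> {0..1}" "t \<in> {0..1}" for s t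
  proof (rule ccontr)
    assume neg: "\<not> ?thesis"
    define \<eta> where "\<eta> = (distance (\<gamma> s) (\<gamma> t) - (L + 1) * \<bar>s - t\<bar>) / 2"
    have \<eta>: "0 < \<eta>" using neg by (simp add: \<eta>_def)
    have "open (X.mball z \<eta>)" for z using X.openin_mball[of z \<eta>] by (simp add: mtopology_eq)
    then have "\<exists>\<^sub>F n in sequentially. (\<sigma> n s, \<sigma> n t) \<in> X.mball (\<gamma> s) \<eta> \<times> X.mball (\<gamma> t) \<eta>"
      using \<eta> st by (intro cluster' open_Times) auto
    then obtain n where n: "distance (\<gamma> s) (\<sigma> n s) < \<eta>" "distance (\<gamma> t) (\<sigma> n t) < \<eta>"
      by (auto dest: frequently_ex)
    have "distance (\<gamma> s) (\<gamma> t) \<le> distance (\<gamma> s) (\<sigma> n s) + distance (\<sigma> n s) (\<gamma> t)"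
      "distance (\<sigma> n s) (\<gamma> t) \<le> distance (\<sigma> n s) (\<sigma> n t) + distance (\<sigma> n t) (\<gamma> t)"
      by (rule X.triangle; simp)+
    then show False using n lip[OF st, of n] X.commute[of "\<sigma> n t" "\<gamma> t"] by (simp add: \<eta>_def field_simps)
  qed
  have cont: "continuous_on {0..1} \<gamma>"
    unfolding continuous_on_topological
  proof (intro ballI allI impI)
    fix s B assume s: "s \<in> {0..1}" and B: "open B" "\<gamma> s \<in> B"
    then obtain e where e: "0 < e" "X.mball (\<gamma> s) e \<subseteq> B"
      using X.openin_mtopology[of B] by (auto simp: mtopology_eq)
    have "\<gamma> t \<in> B" if t: "t \<in> {0..1}" "t \<in> ball s (e / (L + 1))" for t
    proof -
      have "distance (\<gamma> s) (\<gamma> t) \<le> (L + 1) * \<bar>s - t\<bar>" by (rule \<gamma>lip[OF s t(1)])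
      also have "\<dots> < e" using t(2) L(2) by (simp add: dist_real_def field_simps)
      finally show ?thesis using e(2) by auto
    qed
    then show "\<exists>S. open S \<and> s \<in> S \<and> (\<forall>t\<in>{0..1}. t \<in> S \<longrightarrow> \<gamma> t \<in> B)"
      using e(1) L(2) by (intro exI[of _ "ball s (e / (L + 1))"]) auto
  qed
  have "rho_Y A g Y (\<gamma> s) (\<gamma> t) \<le> ennreal (t - s) * rho_Y A g Y x y" if st: "0 \<le> s" "s < t" "t \<le> 1" for s t
  proof (rule ccontr)
    assume "\<not> ?thesis"
    then have "ennreal ((t - s) * L) < Liminf (inf (nhds (\<gamma> s, \<gamma> t)) (principal (I \<times> I))) f"
      using L st unfolding rho[symmetric] by (simp add: ennreal_mult not_le)
    \<comment> \<open>near \<open>(\<gamma> s, \<gamma> t)\<close> interior points have distance above \<open>c\<close>, but infinitely many \<open>\<sigma> n\<close> come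
      near with a distance below \<open>c\<close>\<close>
    then obtain c where c: "ennreal ((t - s) * L) < c"
      "c < Liminf (inf (nhds (\<gamma> s, \<gamma> t)) (principal (I \<times> I))) f" using dense by blast
    obtain S where S: "open S" "(\<gamma> s, \<gamma> t) \<in> S" "\<And>p. p \<in> S \<Longrightarrow> p \<in> I \<times> I \<Longrightarrow> c < f p"
      using less_LiminfD[OF c(2)] unfolding eventually_inf_principal eventually_nhds by blast
    have "(\<lambda>n. ennreal ((t - s) * b n)) \<longlonglongrightarrow> ennreal ((t - s) * L)"
      by (intro tendsto_ennrealI tendsto_mult tendsto_const b_lim)
    then have ev: "\<forall>\<^sub>F n in sequentially. ennreal ((t - s) * b n) < c"
      using c(1) by (rule order_tendstoD(2))
    have fr: "\<exists>\<^sub>F n in sequentially. (\<sigma> n s, \<sigma> n t) \<in> S"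
      using S(1,2) st by (intro cluster') auto
    obtain n where n: "(\<sigma> n s, \<sigma> n t) \<in> S" "ennreal ((t - s) * b n) < c"
      using frequently_ex[OF frequently_eventually_frequently[OF fr ev]] by blast
    have "c < path_dist A g I (\<sigma> n s) (\<sigma> n t)"
      using S(3)[OF n(1)] in_I[of s n] in_I[of t n] st by (simp add: f_def)
    then show False using \<sigma>le[OF st, of n] n(2) by auto
  qed
  from shortest_pathI[OF i ii xy(3) cont _ ends this] \<gamma>Y show ?thesis by blast
qed

end

text \<open>
  A shortest path that touches the boundary in between is visible in the distances between three
  boundary points, and \<open>f\<close> preserves these.
\<close>
lemma circ_property_transfer:
  fixes A :: "('a::{t2_space, second_countable_topology}, 'e::euclidean_space) chart set"
    and Y1 Y2 :: "'a set"
  assumes riem: "connected_riemannian A g" and complete: "complete_riemannian A g"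
    and adm1: "admissible A g Y1"
    and circ: "circ_property A g Y1"
    and surj: "f ` mbdry TYPE('e) Y1 = mbdry TYPE('e) Y2"
    and iso: "\<And>x y. x \<in> mbdry TYPE('e) Y1 \<Longrightarrow> y \<in> mbdry TYPE('e) Y1 \<Longrightarrow>
       rho_Y A g Y2 (f x) (f y) = rho_Y A g Y1 x y"
  shows "circ_property A g Y2"
  unfolding circ_property_def
proof (intro ballI allI impI image_subsetI)
  fix x y \<gamma> t
  assume x: "x \<in> mbdry TYPE('e) Y2" and y: "y \<in> mbdry TYPE('e) Y2"
    and sp: "shortest_path A g Y2 x y \<gamma>" and t: "t \<in> {0<..<1::real}"
  interpret connected_riemannian A g by (rule riem)
  show "\<gamma> t \<in> mint TYPE('e) Y2"
  proof (rule ccontr)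
    assume neg: "\<gamma> t \<notin> mint TYPE('e) Y2"
    have "\<gamma> t \<in> Y2" using sp t by (auto simp: shortest_path_def)
    then have z: "\<gamma> t \<in> mbdry TYPE('e) Y2" using neg by (simp add: mint_def)
    have xy: "x \<noteq> y" "\<gamma> 0 = x" "\<gamma> 1 = y"
      and \<gamma>: "\<And>s t. 0 \<le> s \<Longrightarrow> s < t \<Longrightarrow> t \<le> 1 \<Longrightarrow> rho_Y A g Y2 (\<gamma> s) (\<gamma> t) = ennreal (t - s) * rho_Y A g Y2 x y"
      using sp by (auto simp: shortest_path_def)
    have pre: "\<exists>u\<in>mbdry TYPE('e) Y1. f u = v" if "v \<in> mbdry TYPE('e) Y2" for v
      using that unfolding surj[symmetric] by (auto simp: image_iff)
    obtain a where a: "a \<in> mbdry TYPE('e) Y1" "f a = x" using pre[OF x] by (elim bexE)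
    obtain b where b: "b \<in> mbdry TYPE('e) Y1" "f b = y" using pre[OF y] by (elim bexE)
    obtain c where c: "c \<in> mbdry TYPE('e) Y1" "f c = \<gamma> t" using pre[OF z] by (elim bexE)
    have ac: "rho_Y A g Y1 a c = ennreal t * rho_Y A g Y1 a b"
      using \<gamma>[of 0 t] iso[OF a(1) c(1)] iso[OF a(1) b(1)] a b c t xy by simp
    have cb: "rho_Y A g Y1 c b = ennreal (1 - t) * rho_Y A g Y1 a b"
      using \<gamma>[of t 1] iso[OF c(1) b(1)] iso[OF a(1) b(1)] a b c t xy by simp
    have Y1: "closed Y1" "cond_i A g Y1" "cond_ii A g Y1" using adm1 by (auto simp: admissible_def)
    have in_Y1: "a \<in> Y1" "b \<in> Y1" "c \<in> Y1" using a b c by (auto simp: mbdry_def)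
    interpret R: Metric_space Y1 "\<lambda>x y. enn2real (rho_Y A g Y1 x y)"
      using Y1(3) by (simp add: cond_ii_def)
    have ab: "a \<noteq> b" using xy(1) a(2) b(2) by auto
    have "enn2real (rho_Y A g Y1 a b) \<noteq> 0" using R.zero[OF in_Y1(1,2)] ab by simp
    then have "enn2real (rho_Y A g Y1 a c) \<noteq> 0" "enn2real (rho_Y A g Y1 c b) \<noteq> 0"
      unfolding ac cb using t by (auto simp: enn2real_mult)
    then have "a \<noteq> c" "c \<noteq> b"
      using R.zero[OF in_Y1(1,3)] R.zero[OF in_Y1(3,2)] by auto
    then obtain \<gamma>1 \<gamma>2 where "shortest_path A g Y1 a c \<gamma>1" "shortest_path A g Y1 c b \<gamma>2"
      using shortest_path_exists[OF complete Y1] in_Y1 by metis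
    then obtain \<delta> where \<delta>: "shortest_path A g Y1 a b \<delta>" "\<delta> t = c"
      by (rule shortest_path_join[OF Y1(2,3) _ _ ab _ _ ac cb]) (use t in auto)
    have "\<delta> ` {0<..<1} \<subseteq> mint TYPE('e) Y1"
      using circ \<delta>(1) a(1) b(1) by (auto simp: circ_property_def)
    then have "c \<in> mint TYPE('e) Y1" using \<delta>(2) t by blast
    then show False using c(1) by (simp add: mint_def)
  qed
qed

theorem theorem3p10:
  fixes A :: "('a::{t2_space, second_countable_topology}, 'e::euclidean_space) chart set"
    and g :: "('a, 'e) metric_tensor"
    and Y1 Y2 :: "'a set"
  assumes "DIM('e) \<ge> 3"
    and "smooth_atlas A"
    and "connected (UNIV :: 'a set)"
    and "riemannian_metric A g"
    and "complete_riemannian A g"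
    and "admissible A g Y1"
    and "admissible A g Y2"
    and "circ_property A g Y1"
    and "\<And>Y x y. \<lbrakk>admissible A g Y; circ_property A g Y;
            x \<in> mbdry TYPE('e) Y; y \<in> mbdry TYPE('e) Y\<rbrakk> \<Longrightarrow> rho_X A g x y = rho_Y A g Y x y"
    and "isometric_wrt (rho_Y A g Y1) (mbdry TYPE('e) Y1) (rho_Y A g Y2) (mbdry TYPE('e) Y2)"
  shows "isometric_wrt (rho_X A g) (mbdry TYPE('e) Y1) (rho_X A g) (mbdry TYPE('e) Y2)"
proof -
  have riem: "connected_riemannian A g"
    using assms(2-4) by (intro connected_riemannian.intro riemannian.intro connected_riemannian_axioms.intro)
  obtain f where f: "f ` mbdry TYPE('e) Y1 = mbdry TYPE('e) Y2"
    "\<And>x y. x \<in> mbdry TYPE('e) Y1 \<Longrightarrow> y \<in> mbdry TYPE('e) Y1 \<Longrightarrow>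
       rho_Y A g Y2 (f x) (f y) = rho_Y A g Y1 x y"
    using assms(10) unfolding isometric_wrt_def by blast
  have circ2: "circ_property A g Y2"
    by (rule circ_property_transfer[OF riem assms(5,6,8) f])
  have "rho_X A g (f x) (f y) = rho_X A g x y"
    if "x \<in> mbdry TYPE('e) Y1" "y \<in> mbdry TYPE('e) Y1" for x y
  proof -
    have "f x \<in> mbdry TYPE('e) Y2" "f y \<in> mbdry TYPE('e) Y2" using that unfolding f(1)[symmetric] by simp_all
    then show ?thesis
      using assms(9)[OF assms(7) circ2] assms(9)[OF assms(6,8) that] f(2)[OF that] by simp
  qed
  then show ?thesis unfolding isometric_wrt_def using f(1) by blast
qed

end
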